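(* Let $K\subset\mathbb{C}$ be the closure of a bounded open set having $C^2$-smooth boundary, and assume that $K$ has logarithmic capacity $1$. Then $\inf_{n}\kappa_n(K,1)=0$, where the infimum is over all positive integers $n$.
   Context: For compact $K\subseteq\mathbb{C}$, $\mathcal{P}_n(K)$ is the set of monic complex polynomials of degree $n$ all of whose zeros lie in $K$. For a polynomial $p$ and $t>0$, $\Lambda_p(t)=\{z\in\mathbb{C}: |p(z)|\le t\}$. $m$ is Lebesgue measure on $\mathbb{C}$, and $\kappa_n(K,t)=\inf\{m(\Lambda_p(t)): p\in\mathcal{P}_n(K)\}$. *)

theory Defs
  imports "HOL-Probability.Probability" "HOL-Computational_Algebra.Polynomial"
begin

definition monic_polys_with_zeros_in :: "nat \<Rightarrow> complex set \<Rightarrow> complex poly set" where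
  "monic_polys_with_zeros_in n K =
     {p. degree p = n \<and> lead_coeff p = 1 \<and> (\<forall>z. poly p z = 0 \<longrightarrow> z \<in> K)}"

definition lemniscate :: "complex poly \<Rightarrow> real \<Rightarrow> complex set" where
  "lemniscate p t = {z. norm (poly p z) \<le> t}"

definition kappa :: "nat \<Rightarrow> complex set \<Rightarrow> real \<Rightarrow> ennreal" where
  "kappa n K t = (INF p\<in>monic_polys_with_zeros_in n K. emeasure lebesgue (lemniscate p t))"

(* log (1 / |z - w|); the case z = w is separate because ln 0 = 0 in HOL. *)
definition log_kernel :: "complex \<Rightarrow> complex \<Rightarrow> ereal" where
  "log_kernel z w = (if z = w then \<infinity> else ereal (- ln (dist z w)))"

(* Positive part minus negative part: e2ennreal sends negative values to 0.
   For mu carried by a bounded set the subtrahend is finite. *)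
definition log_energy :: "complex measure \<Rightarrow> ereal" where
  "log_energy \<mu> =
     enn2ereal (\<integral>\<^sup>+ z. (\<integral>\<^sup>+ w. e2ennreal (log_kernel z w) \<partial>\<mu>) \<partial>\<mu>)
     - enn2ereal (\<integral>\<^sup>+ z. (\<integral>\<^sup>+ w. e2ennreal (- log_kernel z w) \<partial>\<mu>) \<partial>\<mu>)"

definition borel_probs_on :: "complex set \<Rightarrow> complex measure set" where
  "borel_probs_on K = {\<mu>. prob_space \<mu> \<and> sets \<mu> = sets borel \<and> emeasure \<mu> K = 1}"

definition robin_constant :: "complex set \<Rightarrow> ereal" where
  "robin_constant K = (INF \<mu>\<in>borel_probs_on K. log_energy \<mu>)"

(* exp (- V) with V the Robin constant of the compact set K; V = \<infinity> for polar (e.g. empty) K. *)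
definition log_capacity :: "complex set \<Rightarrow> ereal" where
  "log_capacity K =
     (case robin_constant K of
        ereal v \<Rightarrow> ereal (exp (- v))
      | PInfty \<Rightarrow> 0
      | MInfty \<Rightarrow> \<infinity>)"

definition C2_on :: "real set \<Rightarrow> (real \<Rightarrow> real) \<Rightarrow> bool" where
  "C2_on I g \<longleftrightarrow>
     (\<exists>g' g''. (\<forall>x\<in>I. (g has_real_derivative g' x) (at x)) \<and>
               (\<forall>x\<in>I. (g' has_real_derivative g'' x) (at x)) \<and>
               continuous_on I g'')"

(* Near each boundary point, after rotating coordinates by the unimodular factor u,
   \<Omega> is exactly the region above the graph of a C^2 function. *)
definition C2_boundary :: "complex set \<Rightarrow> bool" where
  "C2_boundary \<Omega> \<longleftrightarrow>
     (\<forall>p\<in>frontier \<Omega>. \<exists>r>0. \<exists>u g. norm u = 1 \<and>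
        C2_on {Re (u * p) - r <..< Re (u * p) + r} g \<and>
        \<Omega> \<inter> ball p r = {z \<in> ball p r. Im (u * z) > g (Re (u * z))})"

end

theory Submission
  imports Defs
    "HOL-Complex_Analysis.Complex_Analysis"
    "HOL-Computational_Algebra.Fundamental_Theorem_Algebra"
    "HOL-Real_Asymp.Real_Asymp"
begin

text \<open>
  Let \<open>p\<close> be monic with distinct zeros \<open>z\<^sub>1, \<dots>, z\<^sub>n\<close> in \<open>K\<close> and let \<open>g\<close> be a polynomial with
  \<open>N deg g < n\<close>. If \<open>\<bar>p' (z\<^sub>i)\<bar> \<ge> \<mu> \<bar>g (z\<^sub>i)\<bar>\<^sup>N\<close> for all \<open>i\<close>, then Lagrange interpolation of \<open>g\<^sup>N\<close> at the
  \<open>z\<^sub>i\<close> gives \<open>\<bar>p\<bar> \<ge> \<mu> \<bar>g\<bar>\<^sup>N dist (-, {z\<^sub>i}) / n\<close>. So it suffices that \<open>\<bar>g\<bar> \<ge> 1\<close> off a set of small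
  area and that \<open>\<mu>\<close> is exponentially large.

  The nodes nearly maximise the weighted energy
  \<open>\<Sum>\<^sub>i\<^sub>\<noteq>\<^sub>j log \<bar>z\<^sub>i - z\<^sub>j\<bar> - 2 N \<Sum>\<^sub>i log \<bar>g (z\<^sub>i)\<bar>\<close>. Testing with independent points distributed by a
  measure \<open>\<nu>\<close> of almost minimal logarithmic energy, which is almost \<open>0\<close> because the capacity is \<open>1\<close>,
  and varying \<open>N\<close>, one sees that \<open>\<bar>p' (z\<^sub>i)\<bar> / \<bar>g (z\<^sub>i)\<bar>\<^sup>N\<close> is exponentially large for some \<open>i\<close> as soon as
  \<open>\<integral> log \<bar>g\<bar> d\<nu> < 0\<close>. It is then so for all \<open>i\<close>, by a Bernstein-Walsh estimate on segments in \<open>K\<close>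
  that end at the nodes; this is the only use of the regularity of the boundary.

  A suitable \<open>g\<close> is found among finitely many polynomials \<open>g\<^sub>j\<close> with \<open>\<Sum>\<^sub>j log \<bar>g\<^sub>j\<bar> < 0\<close> on \<open>K\<close>, each of
  modulus at least \<open>1\<close> off a thin vertical strip. They come from a polynomial approximation, in the
  manner of Runge, of the characteristic function of a half-plane.
\<close>

section \<open>Growth and interpolation of polynomials\<close>

text \<open>The Joukowski map \<open>w |-> (w + 1 / w) / 2\<close> carries the unit circle onto the
  segment, and the factor \<open>w ^ n\<close> removes the pole at \<open>0\<close>. The maximum
  principle on the unit disc then yields this Bernstein-Walsh bound.\<close>

lemma poly_growth_off_segment:
  fixes P :: "complex poly" and a v :: complex and \<rho> M :: real
  assumes deg: "degree P \<le> n" and \<rho>: "\<rho> > 1"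
    and le: "\<And>s::real. \<bar>s\<bar> \<le> 1 \<Longrightarrow> cmod (poly P (a + of_real s * v)) \<le> M"
  shows "cmod (poly P (a + of_real ((\<rho> + 1 / \<rho>) / 2) * v)) \<le> \<rho> ^ n * M"
proof -
  define Q where "Q = pcompose P [:a, v:]"
  have Q: "poly Q x = poly P (a + x * v)" for x
    by (simp add: Q_def poly_pcompose mult.commute)
  have "degree Q \<le> degree P * degree [:a, v:]"
    unfolding Q_def by (rule degree_pcompose_le)
  also have "\<dots> \<le> n * 1"
    using deg by (intro mult_mono) auto
  finally have degQ: "degree Q \<le> n" by simp
  \<comment> \<open>This is \<open>w ^ n * poly Q ((w + 1 / w) / 2)\<close> with denominators
    cleared, hence a polynomial in \<open>w\<close>.\<close>
  define F where "F = (\<lambda>w::complex. \<Sum>k\<le>n. coeff Q k * w ^ (n - k) * ((w\<^sup>2 + 1) / 2) ^ k)"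
  have F: "F w = w ^ n * poly Q ((w + 1 / w) / 2)" if "w \<noteq> 0" for w
  proof -
    have eq: "(w + 1 / w) / 2 = ((w\<^sup>2 + 1) / 2) / w"
      using that by (simp add: field_simps power2_eq_square)
    have "poly Q x = (\<Sum>k\<le>n. coeff Q k * x ^ k)" for x
      unfolding poly_altdef using degQ
      by (intro sum.mono_neutral_left) (auto simp: coeff_eq_0)
    moreover have "w ^ n = w ^ (n - k) * w ^ k" if "k \<le> n" for k
      using that by (simp add: power_add[symmetric])
    ultimately show ?thesis
      using that unfolding F_def eq
      by (auto simp: sum_distrib_left power_divide field_simps intro!: sum.cong)
  qed
  \<comment> \<open>The Joukowski map takes the same value at \<open>\<rho>\<close> and at
    \<open>1 / \<rho>\<close>, and the latter lies in the disc.\<close>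
  have "cmod (F (of_real (1 / \<rho>))) \<le> M"
  proof (rule maximum_modulus_frontier[where S = "cball 0 1" and f = F])
    show "F holomorphic_on interior (cball 0 1)"
      unfolding F_def by (intro holomorphic_intros) auto
    show "continuous_on (closure (cball 0 1)) F"
      unfolding F_def by (intro continuous_intros) auto
    show "cmod (F z) \<le> M" if "z \<in> frontier (cball 0 1)" for z
    proof -
      have z: "cmod z = 1" using that by (simp add: frontier_cball)
      then have "z \<noteq> 0" by auto
      have "z * cnj z = 1" using z complex_norm_square[of z] by simp
      then have "1 / z = cnj z" using \<open>z \<noteq> 0\<close> by (simp add: field_simps)
      then have "(z + 1 / z) / 2 = of_real (Re z)"
        by (simp add: complex_eq_iff)
      moreover have "\<bar>Re z\<bar> \<le> 1" using abs_Re_le_cmod[of z] z by simp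
      ultimately show ?thesis
        using F[OF \<open>z \<noteq> 0\<close>] le[of "Re z"] z by (simp add: norm_mult norm_power Q)
    qed
  qed (use \<rho> in \<open>auto simp: norm_divide\<close>)
  moreover have "F (of_real (1 / \<rho>)) = of_real (1 / \<rho>) ^ n * poly Q (of_real ((\<rho> + 1 / \<rho>) / 2))"
    using F[of "of_real (1 / \<rho>)"] \<rho> by (simp add: add.commute)
  ultimately have "(1 / \<rho>) ^ n * cmod (poly Q (of_real ((\<rho> + 1 / \<rho>) / 2))) \<le> M"
    using \<rho> by (simp add: norm_mult norm_power norm_divide)
  then show ?thesis
    using \<rho> by (simp add: Q field_simps)
qed

lemma lagrange_interpolation:
  fixes q :: "'a::field poly" and z :: "nat \<Rightarrow> 'a"
  assumes inj: "inj_on z {..<n}" and deg: "degree q < n"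
  shows "poly q x = (\<Sum>i<n. poly q (z i) * (\<Prod>j\<in>{..<n}-{i}. (x - z j) / (z i - z j)))"
proof -
  define L where "L = (\<lambda>i. smult (poly q (z i)) (\<Prod>j\<in>{..<n}-{i}. smult (1 / (z i - z j)) [:- z j, 1:]))"
  have polyL: "poly (L i) y = poly q (z i) * (\<Prod>j\<in>{..<n}-{i}. (y - z j) / (z i - z j))" for i y
    by (simp add: L_def poly_prod diff_divide_distrib)
  have "q = (\<Sum>i<n. L i)"
  proof (rule poly_eqI_degree[where A = "z ` {..<n}"])
    have card: "card (z ` {..<n}) = n"
      using inj by (simp add: card_image)
    show "card (z ` {..<n}) > degree q" using deg card by simp
    have "degree (L i) \<le> n - 1" if "i < n" for i
    proof -
      have "degree (L i) \<le> degree (\<Prod>j\<in>{..<n}-{i}. smult (1 / (z i - z j)) [:- z j, 1:])"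
        unfolding L_def by (rule degree_smult_le)
      also have "\<dots> \<le> (\<Sum>j\<in>{..<n}-{i}. degree (smult (1 / (z i - z j)) [:- z j, 1:]))"
        by (rule order_trans[OF degree_prod_sum_le]) (auto simp: o_def)
      also have "\<dots> \<le> (\<Sum>j\<in>{..<n}-{i}. 1)"
        by (intro sum_mono) (auto intro: order_trans[OF degree_smult_le])
      also have "\<dots> = n - 1" using that by simp
      finally show ?thesis .
    qed
    then have "degree (\<Sum>i<n. L i) \<le> n - 1"
      by (intro degree_sum_le) auto
    then show "card (z ` {..<n}) > degree (\<Sum>i<n. L i)"
      using deg card by linarith
    fix y assume "y \<in> z ` {..<n}"
    then obtain k where k: "k < n" "y = z k" by auto
    have "poly (L i) y = (if i = k then poly q y else 0)" if "i < n" for i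
    proof (cases "i = k")
      case True
      have "(\<Prod>j\<in>{..<n}-{k}. (z k - z j) / (z k - z j)) = 1"
        using inj k by (intro prod.neutral) (auto simp: inj_on_def)
      then show ?thesis using True k by (simp add: polyL)
    next
      case False
      have "(\<Prod>j\<in>{..<n}-{i}. (z k - z j) / (z i - z j)) = 0"
        using False k by (intro prod_zero) auto
      then show ?thesis using False k by (simp add: polyL)
    qed
    then show "poly q y = poly (\<Sum>i<n. L i) y"
      using k by (simp add: poly_sum)
  qed
  then have "poly q x = poly (\<Sum>i<n. L i) x" by simp
  then show ?thesis by (simp add: poly_sum polyL)
qed

section \<open>Polynomial approximation of a step function\<close>

definition poly_approximable :: "complex set \<Rightarrow> (complex \<Rightarrow> complex) \<Rightarrow> bool" where
  "poly_approximable X f \<longleftrightarrow> (\<forall>e>0. \<exists>p. \<forall>z\<in>X. cmod (poly p z - f z) < e)"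

lemma poly_approximable_poly [intro]: "poly_approximable X (poly p)"
  unfolding poly_approximable_def by (intro allI impI exI[of _ p]) auto

lemma poly_approximable_cong:
  "poly_approximable X f \<Longrightarrow> (\<And>z. z \<in> X \<Longrightarrow> f z = g z) \<Longrightarrow> poly_approximable X g"
  unfolding poly_approximable_def by auto

lemma poly_approximable_limit:
  assumes "\<And>e. e > 0 \<Longrightarrow> \<exists>g. poly_approximable X g \<and> (\<forall>z\<in>X. cmod (g z - f z) < e)"
  shows "poly_approximable X f"
  unfolding poly_approximable_def
proof (intro allI impI)
  fix e :: real assume "e > 0"
  then have e: "e / 2 > 0" by simp
  obtain g where g: "poly_approximable X g" "\<forall>z\<in>X. cmod (g z - f z) < e / 2"
    using assms[OF e] by blast
  obtain p where p: "\<forall>z\<in>X. cmod (poly p z - g z) < e / 2"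
    using g(1) e unfolding poly_approximable_def by blast
  have "cmod (poly p z - f z) < e" if "z \<in> X" for z
    using norm_triangle_ineq[of "poly p z - g z" "g z - f z"] g(2) p that
    by fastforce
  then show "\<exists>p. \<forall>z\<in>X. cmod (poly p z - f z) < e" by blast
qed

lemma poly_approximable_add:
  assumes f: "poly_approximable X f" and g: "poly_approximable X g"
  shows "poly_approximable X (\<lambda>z. f z + g z)"
  unfolding poly_approximable_def
proof (intro allI impI)
  fix e :: real assume "e > 0"
  then have e: "e / 2 > 0" by simp
  obtain p where p: "\<forall>z\<in>X. cmod (poly p z - f z) < e / 2"
    using f e unfolding poly_approximable_def by blast
  obtain q where q: "\<forall>z\<in>X. cmod (poly q z - g z) < e / 2"
    using g e unfolding poly_approximable_def by blast
  have "cmod (poly (p + q) z - (f z + g z)) < e" if "z \<in> X" for z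
  proof -
    have eq: "poly (p + q) z - (f z + g z) = (poly p z - f z) + (poly q z - g z)" by simp
    moreover have "cmod (poly p z - f z) < e / 2" "cmod (poly q z - g z) < e / 2"
      using p q that by auto
    ultimately show ?thesis
      unfolding eq using norm_triangle_ineq[of "poly p z - f z" "poly q z - g z"] by linarith
  qed
  then show "\<exists>p. \<forall>z\<in>X. cmod (poly p z - (f z + g z)) < e" by blast
qed

lemma poly_approximable_mult:
  assumes f: "poly_approximable X f" and g: "poly_approximable X g"
    and B: "\<And>z. z \<in> X \<Longrightarrow> cmod (f z) \<le> B" and C: "\<And>z. z \<in> X \<Longrightarrow> cmod (g z) \<le> C"
  shows "poly_approximable X (\<lambda>z. f z * g z)"
  unfolding poly_approximable_def
proof (intro allI impI)
  fix e :: real assume "e > 0"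
  define d where "d = min 1 (e / (2 * (\<bar>B\<bar> + \<bar>C\<bar> + 1)))"
  have d: "d > 0" "d \<le> 1" using \<open>e > 0\<close> by (auto simp: d_def)
  have "d * (\<bar>B\<bar> + \<bar>C\<bar> + 1) \<le> e / (2 * (\<bar>B\<bar> + \<bar>C\<bar> + 1)) * (\<bar>B\<bar> + \<bar>C\<bar> + 1)"
    by (intro mult_right_mono) (auto simp: d_def)
  also have "\<dots> < e" using \<open>e > 0\<close> by (simp add: field_simps add_pos_nonneg)
  finally have de: "d * (\<bar>B\<bar> + \<bar>C\<bar> + 1) < e" .
  obtain p where p: "\<forall>z\<in>X. cmod (poly p z - f z) < d"
    using f d unfolding poly_approximable_def by blast
  obtain q where q: "\<forall>z\<in>X. cmod (poly q z - g z) < d"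
    using g d unfolding poly_approximable_def by blast
  have "cmod (poly (p * q) z - f z * g z) < e" if z: "z \<in> X" for z
  proof -
    have "poly (p * q) z - f z * g z
        = (poly p z - f z) * (poly q z - g z) + f z * (poly q z - g z) + (poly p z - f z) * g z"
      by (simp add: algebra_simps)
    also have "cmod \<dots> \<le> cmod (poly p z - f z) * cmod (poly q z - g z)
        + cmod (f z) * cmod (poly q z - g z) + cmod (poly p z - f z) * cmod (g z)"
      by (intro order_trans[OF norm_triangle_ineq] add_mono order_refl) (simp_all add: norm_mult)
    also have "\<dots> \<le> d * 1 + \<bar>B\<bar> * d + d * \<bar>C\<bar>"
      using p q z d B[OF z] C[OF z]
      by (intro add_mono mult_mono) (auto intro: less_imp_le order_trans[OF less_imp_le])
    also have "\<dots> = d * (\<bar>B\<bar> + \<bar>C\<bar> + 1)" by (simp add: algebra_simps)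
    finally show ?thesis using de by simp
  qed
  then show "\<exists>p. \<forall>z\<in>X. cmod (poly p z - f z * g z) < e" by blast
qed

lemma poly_approximable_prod:
  assumes "finite I"
    and "\<And>i. i \<in> I \<Longrightarrow> poly_approximable X (f i)"
    and "\<And>i z. i \<in> I \<Longrightarrow> z \<in> X \<Longrightarrow> cmod (f i z) \<le> B"
  shows "poly_approximable X (\<lambda>z. \<Prod>i\<in>I. f i z)"
  using assms
proof (induction I)
  case empty
  then show ?case
    by (auto intro: poly_approximable_cong[OF poly_approximable_poly[of X 1]])
next
  case (insert i I)
  have "cmod (\<Prod>i\<in>I. f i z) \<le> (\<bar>B\<bar> + 1) ^ card I" if "z \<in> X" for z
  proof -
    have "cmod (f i z) \<le> \<bar>B\<bar> + 1" if "i \<in> I" for i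
      using insert.prems(2)[of i z] that \<open>z \<in> X\<close> by simp
    then show ?thesis
      unfolding prod_norm[symmetric] by (intro prod_le_power) auto
  qed
  then have "poly_approximable X (\<lambda>z. f i z * (\<Prod>i\<in>I. f i z))"
    using insert by (intro poly_approximable_mult[where B = B and C = "(\<bar>B\<bar> + 1) ^ card I"]) auto
  then show ?case using insert.hyps by simp
qed

text \<open>Partial sums of the geometric series converge uniformly: the bound \<open>1 / 2\<close>
  makes the remainder at most \<open>2 * (1 / 2) ^ N\<close>.\<close>

lemma poly_approximable_geometric:
  assumes f: "poly_approximable X f" and le: "\<And>z. z \<in> X \<Longrightarrow> cmod (f z) \<le> 1 / 2"
  shows "poly_approximable X (\<lambda>z. 1 / (1 - f z))"
proof (rule poly_approximable_limit)
  fix e :: real assume "e > 0"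
  then obtain N where N: "(1 / 2 :: real) ^ N < e / 2"
    using real_arch_pow_inv[of "e / 2" "1 / 2"] by auto
  have pow: "poly_approximable X (\<lambda>z. f z ^ k)" for k
    using poly_approximable_prod[of "{..<k}" X "\<lambda>_. f" "1 / 2"] f le by simp
  have "poly_approximable X (\<lambda>z. \<Sum>k<N. f z ^ k)"
  proof (induction N)
    case 0
    then show ?case
      by (auto intro: poly_approximable_cong[OF poly_approximable_poly[of X 0]])
  next
    case (Suc N)
    then show ?case using poly_approximable_add[OF _ pow] by simp
  qed
  moreover have "cmod ((\<Sum>k<N. f z ^ k) - 1 / (1 - f z)) < e" if z: "z \<in> X" for z
  proof -
    have ne: "f z \<noteq> 1" using le[OF z] by auto
    have ge: "cmod (1 - f z) \<ge> 1 / 2"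
      using norm_triangle_ineq2[of 1 "f z"] le[OF z] by simp
    have "(\<Sum>k<N. f z ^ k) - 1 / (1 - f z) = - (f z ^ N) / (1 - f z)"
    proof -
      have "(1 - f z) * (\<Sum>k<N. f z ^ k) = 1 - f z ^ N"
        by (rule one_diff_power_eq[symmetric])
      then have "(\<Sum>k<N. f z ^ k) = (1 - f z ^ N) / (1 - f z)"
        using ne by (simp add: eq_divide_eq mult.commute)
      then show ?thesis by (simp add: diff_divide_distrib)
    qed
    then have "cmod ((\<Sum>k<N. f z ^ k) - 1 / (1 - f z)) = cmod (f z) ^ N / cmod (1 - f z)"
      by (simp add: norm_divide norm_power)
    also have "\<dots> \<le> (1 / 2) ^ N / (1 / 2)"
      using le[OF z] ge by (intro frac_le power_mono) auto
    also have "\<dots> < e" using N by simp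
    finally show ?thesis .
  qed
  ultimately show "\<exists>g. poly_approximable X g \<and> (\<forall>z\<in>X. cmod (g z - 1 / (1 - f z)) < e)"
    by blast
qed

lemma poly_approximable_cmult:
  assumes "poly_approximable X f" "\<And>z. z \<in> X \<Longrightarrow> cmod (f z) \<le> B"
  shows "poly_approximable X (\<lambda>z. c * f z)"
  using poly_approximable_mult[OF poly_approximable_poly[of X "[:c:]"] assms(1), of "cmod c" B] assms(2)
  by simp

text \<open>The pole is pushed in from infinity along the imaginary axis, which stays away from \<open>X\<close>.\<close>
lemma poly_approximable_imaginary_pole:
  assumes R: "\<And>z. z \<in> X \<Longrightarrow> cmod z \<le> R"
    and \<delta>: "\<delta> > 0" "\<And>z. z \<in> X \<Longrightarrow> \<bar>Re z\<bar> \<ge> \<delta>"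
  shows "poly_approximable X (\<lambda>z. 1 / (z - \<i> * of_real y))"
proof -
  have bd: "cmod (z - \<i> * of_real y) \<ge> \<delta>" if "z \<in> X" for z y
    using abs_Re_le_cmod[of "z - \<i> * of_real y"] \<delta>(2)[OF that] by simp
  have bd': "cmod (1 / (z - \<i> * of_real y)) \<le> 1 / \<delta>" if "z \<in> X" for z y
    using bd[OF that] \<delta>(1) by (simp add: norm_divide frac_le)
  have ne: "z - \<i> * of_real y \<noteq> 0" if "z \<in> X" for z y
    using bd[OF that, of y] \<delta>(1) by auto
  \<comment> \<open>The pole is more than twice as far from the origin as any point of
    \<open>X\<close>, so its reciprocal expands in powers of \<open>z\<close>.\<close>
  define Y where "Y = 2 * \<bar>R\<bar> + 1"
  have far: "poly_approximable X (\<lambda>z. 1 / (z - \<i> * of_real Y))"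
  proof -
    have f: "poly_approximable X (\<lambda>z. (1 / (\<i> * of_real Y)) * z)"
      by (rule poly_approximable_cong[OF poly_approximable_poly[of X "[:0, 1 / (\<i> * of_real Y):]"]]) simp
    have le: "cmod ((1 / (\<i> * of_real Y)) * z) \<le> 1 / 2" if "z \<in> X" for z
    proof -
      have "cmod (\<i> * of_real Y) = Y" by (simp add: norm_mult Y_def del: of_real_add of_real_mult)
      moreover have "cmod z / Y \<le> 1 / 2"
        using R[OF that] by (simp add: Y_def field_simps)
      ultimately show ?thesis by (simp add: norm_mult norm_divide)
    qed
    have "poly_approximable X (\<lambda>z. - (1 / (\<i> * of_real Y)) * (1 / (1 - (1 / (\<i> * of_real Y)) * z)))"
    proof (rule poly_approximable_cmult[OF poly_approximable_geometric[OF f le]])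
      fix z assume z: "z \<in> X"
      have "cmod (1 - 1 / (\<i> * of_real Y) * z) \<ge> 1 / 2"
        using norm_triangle_ineq2[of 1 "1 / (\<i> * of_real Y) * z"] le[OF z] by simp
      then show "cmod (1 / (1 - 1 / (\<i> * of_real Y) * z)) \<le> 1 / (1 / 2)"
        by (simp only: norm_divide norm_one) (intro frac_le, auto)
    qed
    then show ?thesis
    proof (rule poly_approximable_cong)
      fix z assume z: "z \<in> X"
      have "Y \<noteq> 0" by (simp add: Y_def)
      then show "- (1 / (\<i> * of_real Y)) * (1 / (1 - (1 / (\<i> * of_real Y)) * z)) = 1 / (z - \<i> * of_real Y)"
        using ne[OF z, of Y] by (simp add: field_simps)
    qed
  qed
  \<comment> \<open>The new reciprocal is the old one times \<open>1 / (1 - t / (z - i y))\<close>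
    with \<open>t = i (y' - y)\<close>. The quotient has modulus at most \<open>1 / 2\<close>, since
    the old pole is at distance at least \<open>\<delta>\<close> from \<open>X\<close>.\<close>
  have step: "poly_approximable X (\<lambda>z. 1 / (z - \<i> * of_real y'))"
    if P: "poly_approximable X (\<lambda>z. 1 / (z - \<i> * of_real y))" and close: "\<bar>y' - y\<bar> \<le> \<delta> / 2" for y y'
  proof -
    define t where "t = \<i> * of_real (y' - y)"
    have t: "cmod t = \<bar>y' - y\<bar>" by (simp add: t_def norm_mult del: of_real_diff)
    have f: "poly_approximable X (\<lambda>z. t * (1 / (z - \<i> * of_real y)))"
      by (rule poly_approximable_cmult[OF P bd'])
    have le: "cmod (t * (1 / (z - \<i> * of_real y))) \<le> 1 / 2" if "z \<in> X" for z
    proof -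
      have "cmod (t * (1 / (z - \<i> * of_real y))) \<le> \<delta> / 2 * (1 / \<delta>)"
        unfolding norm_mult using bd'[OF that, of y] close t \<delta>(1) by (intro mult_mono) auto
      then show ?thesis using \<delta>(1) by simp
    qed
    have inv: "cmod (1 / (1 - t * (1 / (z - \<i> * of_real y)))) \<le> 1 / (1 / 2)" if "z \<in> X" for z
    proof -
      have "cmod (1 - t * (1 / (z - \<i> * of_real y))) \<ge> 1 / 2"
        using norm_triangle_ineq2[of 1 "t * (1 / (z - \<i> * of_real y))"] le[OF that] by simp
      then show ?thesis
        by (simp only: norm_divide norm_one) (intro frac_le, auto)
    qed
    have "poly_approximable X (\<lambda>z. 1 / (z - \<i> * of_real y) * (1 / (1 - t * (1 / (z - \<i> * of_real y)))))"
      by (rule poly_approximable_mult[OF P poly_approximable_geometric[OF f le] bd' inv])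
    then show ?thesis
    proof (rule poly_approximable_cong)
      fix z assume z: "z \<in> X"
      have "1 - t * (1 / (z - \<i> * of_real y)) = (z - \<i> * of_real y') / (z - \<i> * of_real y)"
        using ne[OF z, of y] by (simp add: t_def field_simps)
      then show "1 / (z - \<i> * of_real y) * (1 / (1 - t * (1 / (z - \<i> * of_real y)))) = 1 / (z - \<i> * of_real y')"
        using ne[OF z, of y] ne[OF z, of y'] by simp
    qed
  qed
  have "\<bar>y - Y\<bar> \<le> real k * (\<delta> / 2) \<Longrightarrow> poly_approximable X (\<lambda>z. 1 / (z - \<i> * of_real y))" for k y
  proof (induction k arbitrary: y)
    case 0
    then show ?case using far by simp
  next
    case (Suc k)
    \<comment> \<open>One step of length at most \<open>\<delta> / 2\<close> from \<open>y\<close>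
      towards \<open>Y\<close>, without passing \<open>Y\<close>.\<close>
    define y0 where "y0 = (if y \<ge> Y then max Y (y - \<delta> / 2) else min Y (y + \<delta> / 2))"
    have "\<bar>y0 - Y\<bar> \<le> real k * (\<delta> / 2)" "\<bar>y - y0\<bar> \<le> \<delta> / 2"
      using Suc.prems \<delta>(1) by (auto simp: y0_def algebra_simps max_def min_def split: if_splits)
    then show ?case using step[OF Suc.IH] by blast
  qed
  moreover obtain k :: nat where "\<bar>y - Y\<bar> / (\<delta> / 2) \<le> real k"
    using real_arch_simple by blast
  then have "\<bar>y - Y\<bar> \<le> real k * (\<delta> / 2)"
    using \<delta>(1) by (simp add: field_simps)
  ultimately show ?thesis by blast
qed

text \<open>Over the complex numbers \<open>D\<close> splits into linear factors whose zeros are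
  imaginary. Their reciprocals are approximable and bounded by \<open>1 / \<delta>\<close> on
  \<open>X\<close>, so the product is approximable too.\<close>

lemma poly_approximable_inverse_poly:
  assumes R: "\<And>z. z \<in> X \<Longrightarrow> cmod z \<le> R"
    and \<delta>: "\<delta> > 0" "\<And>z. z \<in> X \<Longrightarrow> \<bar>Re z\<bar> \<ge> \<delta>"
    and D: "\<And>z. poly D z = 0 \<Longrightarrow> Re z = 0"
  shows "poly_approximable X (\<lambda>z. 1 / poly D z)"
proof -
  obtain r where r: "smult (lead_coeff D) (\<Prod>i<degree D. [:- r i, 1:]) = D"
    using complex_poly_decompose' by blast
  have D0: "D \<noteq> 0" using D[of 1] by auto
  have Dz: "poly D z = lead_coeff D * (\<Prod>i<degree D. (z - r i))" for z
    by (subst r[symmetric]) (simp add: poly_prod)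
  have rre: "r i = \<i> * of_real (Im (r i))" if "i < degree D" for i
  proof -
    have "poly D (r i) = 0"
      using that unfolding Dz by (auto intro!: prod_zero)
    then show ?thesis using D by (simp add: complex_eq_iff)
  qed
  have bd: "cmod (1 / (z - r i)) \<le> 1 / \<delta>" if "z \<in> X" "i < degree D" for z i
  proof -
    have "Re (r i) = 0" using rre[OF that(2)] by (metis Re_i_times Im_complex_of_real neg_0_equal_iff_equal)
    then have "\<delta> \<le> cmod (z - r i)"
      using abs_Re_le_cmod[of "z - r i"] \<delta>(2)[OF that(1)] by simp
    then show ?thesis using \<delta>(1) by (simp add: norm_divide frac_le)
  qed
  have "poly_approximable X (\<lambda>z. 1 / (z - r i))" if "i < degree D" for i
    using poly_approximable_imaginary_pole[OF R \<delta>, where y = "Im (r i)"] rre[OF that] by simp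
  then have P: "poly_approximable X (\<lambda>z. \<Prod>i<degree D. 1 / (z - r i))"
    by (intro poly_approximable_prod[where B = "1 / \<delta>"]) (auto intro: bd)
  have "cmod (\<Prod>i<degree D. 1 / (z - r i)) \<le> (1 / \<delta> + 1) ^ card {..<degree D}" if "z \<in> X" for z
  proof -
    have "cmod (1 / (z - r i)) \<le> 1 / \<delta> + 1" if "i < degree D" for i
      using bd[OF \<open>z \<in> X\<close> that] by linarith
    then show ?thesis
      unfolding prod_norm[symmetric] using \<delta>(1) by (intro prod_le_power) auto
  qed
  from poly_approximable_cmult[OF P this, of "1 / lead_coeff D"]
  have "poly_approximable X (\<lambda>z. 1 / lead_coeff D * (\<Prod>i<degree D. 1 / (z - r i)))"
    by simp
  then show ?thesis
    by (rule poly_approximable_cong) (simp add: Dz prod_dividef)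
qed

text \<open>The Butterworth filter \<open>(1 + z)\<^sup>n / ((1 + z)\<^sup>n + (1 - z)\<^sup>n)\<close> has all its poles on the imaginary axis.\<close>
lemma polynomial_step:
  assumes \<delta>: "\<delta> > 0" and e: "e > 0"
  obtains H :: "complex poly" where
    "\<And>z. cmod z \<le> R \<Longrightarrow> Re z \<ge> \<delta> \<Longrightarrow> cmod (poly H z - 1) < e"
    "\<And>z. cmod z \<le> R \<Longrightarrow> Re z \<le> - \<delta> \<Longrightarrow> cmod (poly H z) < e"
proof -
  define X where "X = {z. cmod z \<le> R \<and> \<bar>Re z\<bar> \<ge> \<delta>}"
  \<comment> \<open>The ratio comes from \<open>|1 - z|^2 = |1 + z|^2 - 4 Re z\<close>. The maximum
    with \<open>1 / 2\<close> keeps \<open>Q\<close> positive when the radicand is not.\<close>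
  define Q where "Q = max (1 / 2) (sqrt (1 - 4 * \<delta> / (1 + \<bar>R\<bar>)\<^sup>2))"
  have Q: "0 < Q" "Q < 1"
    using \<delta> by (auto simp: Q_def add_nonneg_pos)
  have contr: "cmod (1 - z) \<le> Q * cmod (1 + z)" if z: "cmod z \<le> R" "Re z \<ge> \<delta>" for z
  proof -
    have "cmod (1 + z) \<le> 1 + \<bar>R\<bar>" using norm_triangle_ineq[of 1 z] z by simp
    then have sq: "(cmod (1 + z))\<^sup>2 \<le> (1 + \<bar>R\<bar>)\<^sup>2" by (intro power_mono) auto
    have "(cmod (1 - z))\<^sup>2 = (cmod (1 + z))\<^sup>2 - 4 * Re z"
      by (simp add: cmod_power2) (simp add: power2_eq_square algebra_simps)
    also have "\<dots> \<le> (cmod (1 + z))\<^sup>2 - 4 * \<delta>" using z by simp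
    also have "\<dots> \<le> (1 - 4 * \<delta> / (1 + \<bar>R\<bar>)\<^sup>2) * (cmod (1 + z))\<^sup>2"
    proof -
      have "4 * \<delta> / (1 + \<bar>R\<bar>)\<^sup>2 * (cmod (1 + z))\<^sup>2 \<le> 4 * \<delta> / (1 + \<bar>R\<bar>)\<^sup>2 * (1 + \<bar>R\<bar>)\<^sup>2"
        using sq \<delta> by (intro mult_left_mono) auto
      also have "\<dots> = 4 * \<delta>" by simp
      finally show ?thesis by (simp add: left_diff_distrib)
    qed
    finally have *: "(cmod (1 - z))\<^sup>2 \<le> (1 - 4 * \<delta> / (1 + \<bar>R\<bar>)\<^sup>2) * (cmod (1 + z))\<^sup>2" .
    have "cmod (1 - z) = sqrt ((cmod (1 - z))\<^sup>2)" by simp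
    also have "\<dots> \<le> sqrt ((1 - 4 * \<delta> / (1 + \<bar>R\<bar>)\<^sup>2) * (cmod (1 + z))\<^sup>2)"
      using * by (rule real_sqrt_le_mono)
    also have "\<dots> = sqrt (1 - 4 * \<delta> / (1 + \<bar>R\<bar>)\<^sup>2) * cmod (1 + z)"
      by (simp add: real_sqrt_mult)
    also have "\<dots> \<le> Q * cmod (1 + z)"
      by (intro mult_right_mono) (auto simp: Q_def)
    finally show ?thesis .
  qed
  have "(\<lambda>n. Q ^ n) \<longlonglongrightarrow> 0" using Q by (intro LIMSEQ_power_zero) auto
  then have "\<forall>\<^sub>F n in sequentially. Q ^ n < min (1 / 2) (e / 4)"
    using e by (intro order_tendstoD(2)) auto
  then obtain n where n: "Q ^ n < 1 / 2" "Q ^ n < e / 4" by (auto simp: eventually_sequentially)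
  define D :: "complex poly" where "D = [:1, 1:] ^ n + [:1, - 1:] ^ n"
  have D: "poly D z = (1 + z) ^ n + (1 - z) ^ n" for z by (simp add: D_def poly_power)
  define f where "f z = (1 + z) ^ n / ((1 + z) ^ n + (1 - z) ^ n)" for z :: complex
  \<comment> \<open>Stated for \<open>a\<close> and \<open>b\<close> so as to serve both sides:
    \<open>a = 1 + z\<close>, \<open>b = 1 - z\<close> on the right and the reverse on the
    left.\<close>
  have large: "1 / 2 * cmod a ^ n \<le> cmod (a ^ n + b ^ n)"
    if ab: "cmod b \<le> Q * cmod a" for a b :: complex
  proof -
    have "cmod b ^ n \<le> Q ^ n * cmod a ^ n"
      using ab(1) by (metis norm_ge_zero power_mono power_mult_distrib)
    also have "\<dots> \<le> 1 / 2 * cmod a ^ n" using n by (intro mult_right_mono) auto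
    finally have "cmod b ^ n \<le> 1 / 2 * cmod a ^ n" .
    moreover have "cmod (a ^ n + b ^ n) \<ge> cmod a ^ n - cmod b ^ n"
      using norm_triangle_ineq4[of "a ^ n + b ^ n" "b ^ n"] by (simp add: norm_power)
    ultimately show ?thesis by simp
  qed
  have small: "cmod (b ^ n / (a ^ n + b ^ n)) < e / 2"
    if ab: "cmod b \<le> Q * cmod a" "a \<noteq> 0" for a b :: complex
  proof -
    have b: "cmod b ^ n \<le> Q ^ n * cmod a ^ n"
      using ab(1) by (metis norm_ge_zero power_mono power_mult_distrib)
    have a: "cmod a ^ n > 0" using ab(2) by simp
    have "cmod (b ^ n / (a ^ n + b ^ n)) = cmod b ^ n / cmod (a ^ n + b ^ n)"
      by (simp add: norm_divide norm_power)
    also have "\<dots> \<le> (Q ^ n * cmod a ^ n) / (1 / 2 * cmod a ^ n)"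
      using b large[OF ab(1)] a Q by (intro frac_le) auto
    also have "\<dots> = 2 * Q ^ n" using ab(2) by simp
    also have "\<dots> < e / 2" using n by simp
    finally show ?thesis .
  qed
  \<comment> \<open>The dominating one of \<open>1 + z\<close> and \<open>1 - z\<close> has real
    part, hence modulus, at least \<open>1\<close>.\<close>
  have den: "1 / 2 \<le> cmod ((1 + z) ^ n + (1 - z) ^ n)" if z: "z \<in> X" for z
  proof (cases "Re z \<ge> 0")
    case True
    then have "1 \<le> cmod (1 + z)" using complex_Re_le_cmod[of "1 + z"] by simp
    then have "1 \<le> cmod (1 + z) ^ n" by simp
    then show ?thesis using large[OF contr[of z]] z True by (auto simp: X_def)
  next
    case False
    then have "1 \<le> cmod (1 - z)" using complex_Re_le_cmod[of "1 - z"] by simp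
    then have "1 \<le> cmod (1 - z) ^ n" by simp
    then show ?thesis using large[of "1 + z" "1 - z"] contr[of "- z"] z False
      by (auto simp: X_def add.commute)
  qed
  have "poly_approximable X (\<lambda>z. poly ([:1, 1:] ^ n) z * (1 / poly D z))"
  proof (rule poly_approximable_mult)
    \<comment> \<open>A zero of \<open>D\<close> is equidistant from \<open>1\<close> and
      \<open>-1\<close>; for \<open>n = 0\<close> the polynomial is the constant
      \<open>2\<close>.\<close>
    have "Re z = 0" if "poly D z = 0" for z
    proof (cases "n = 0")
      case True
      then show ?thesis using that by (simp add: D)
    next
      case False
      have "(1 + z) ^ n = - ((1 - z) ^ n)" using that D by (simp add: eq_neg_iff_add_eq_0)
      then have "cmod (1 + z) ^ n = cmod (1 - z) ^ n" by (metis norm_minus_cancel norm_power)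
      then have "cmod (1 + z) = cmod (1 - z)"
        using False by (metis norm_ge_zero power_eq_iff_eq_base bot_nat_0.not_eq_extremum)
      then have "(cmod (1 + z))\<^sup>2 = (cmod (1 - z))\<^sup>2" by simp
      then show ?thesis by (simp add: cmod_power2) (simp add: power2_eq_square algebra_simps)
    qed
    then show "poly_approximable X (\<lambda>z. 1 / poly D z)"
      by (intro poly_approximable_inverse_poly[where R = R and \<delta> = \<delta>]) (auto simp: X_def \<delta>)
    show "poly_approximable X (poly ([:1, 1:] ^ n))" ..
    show "cmod (poly ([:1, 1:] ^ n) z) \<le> (1 + R) ^ n" if "z \<in> X" for z
      using that norm_triangle_ineq[of 1 z] by (auto simp: X_def poly_power norm_power intro!: power_mono)
    show "cmod (1 / poly D z) \<le> 1 / (1 / 2)" if "z \<in> X" for z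
      unfolding D norm_divide norm_one by (rule frac_le) (use den[OF that] in auto)
  qed
  then have "poly_approximable X f"
    by (rule poly_approximable_cong) (simp add: D f_def poly_power)
  then obtain H where H: "\<forall>z\<in>X. cmod (poly H z - f z) < e / 2"
    unfolding poly_approximable_def using e by (meson half_gt_zero)
  show thesis
  proof (rule that)
    fix z assume z: "cmod z \<le> R" "Re z \<ge> \<delta>"
    have ne: "1 + z \<noteq> 0" using z \<delta> by (auto simp: complex_eq_iff)
    have den: "(1 + z) ^ n + (1 - z) ^ n \<noteq> 0"
      using den[of z] z \<delta> by (auto simp: X_def)
    have "f z - 1 = - ((1 - z) ^ n / ((1 + z) ^ n + (1 - z) ^ n))"
      using den by (simp add: f_def field_simps)
    then have "cmod (f z - 1) < e / 2" using small[OF contr[OF z] ne] by simp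
    then show "cmod (poly H z - 1) < e"
      using H z norm_triangle_ineq[of "poly H z - f z" "f z - 1"] by (fastforce simp: X_def)
  next
    fix z assume z: "cmod z \<le> R" "Re z \<le> - \<delta>"
    have ne: "1 - z \<noteq> 0" using z \<delta> by (auto simp: complex_eq_iff)
    have "cmod (f z) < e / 2"
      using small[of "1 + z" "1 - z"] contr[of "- z"] z ne by (simp add: f_def add.commute)
    then show "cmod (poly H z) < e"
      using H z norm_triangle_ineq[of "poly H z - f z" "f z"] \<delta> by (fastforce simp: X_def)
  qed
qed

section \<open>Polynomials that are large off a strip and small on average\<close>

text \<open>This is \<open>ln y \<le> y - 1\<close> at \<open>y = |1 + x|^2\<close>. It bounds the
  logarithm by its linear part with a quadratic error.\<close>

lemma ln_cmod_one_plus_le: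
  assumes "1 + x \<noteq> 0"
  shows "ln (cmod (1 + x)) \<le> Re x + (cmod x)\<^sup>2 / 2"
proof -
  have pos: "cmod (1 + x) > 0" using assms by simp
  have "2 * ln (cmod (1 + x)) = ln ((cmod (1 + x))\<^sup>2)"
    using pos by (simp add: ln_realpow)
  also have "\<dots> \<le> (cmod (1 + x))\<^sup>2 - 1"
    using pos by (intro ln_le_minus_one) auto
  also have "\<dots> = 2 * Re x + (cmod x)\<^sup>2"
    by (simp add: cmod_power2) (simp add: power2_eq_square algebra_simps)
  finally show ?thesis by simp
qed

text \<open>
  The increments \<open>H (z - t\<^sub>j) - H (z - t\<^sub>j\<^sub>+\<^sub>1)\<close> of translates of an approximate step \<open>H\<close> are small off
  a strip and telescope to almost \<open>1\<close>.
\<close>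
lemma polynomial_barriers:
  assumes R: "R > 0" and \<delta>: "\<delta> > 0"
  obtains m :: nat and g :: "nat \<Rightarrow> complex poly" and t :: "nat \<Rightarrow> real" and a :: real
  where "m > 0" "a > 0"
    and "\<And>j z. j < m \<Longrightarrow> cmod z \<le> R \<Longrightarrow> poly (g j) z \<noteq> 0"
    and "\<And>j z. j < m \<Longrightarrow> cmod z \<le> R \<Longrightarrow> \<bar>Re z - t j\<bar> > \<delta> \<Longrightarrow> cmod (poly (g j) z) \<ge> 1"
    and "\<And>z. cmod z \<le> R \<Longrightarrow> (\<Sum>j<m. ln (cmod (poly (g j) z))) \<le> - a"
proof -
  define d where "d = \<delta> / 2"
  have d: "d > 0" using \<delta> by (simp add: d_def)
  define m where "m = nat \<lceil>(2 * R + 2 * d) / d\<rceil>"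
  have m: "(2 * R + 2 * d) / d \<le> real m"
    unfolding m_def by (rule real_nat_ceiling_ge)
  then have md: "2 * R + 2 * d \<le> real m * d" using d by (simp add: field_simps)
  have m0: "m > 0" using md R d by (cases m) auto
  \<comment> \<open>The grid has spacing \<open>d\<close> and runs from \<open>- R - d\<close> to at
    least \<open>R + d\<close>. On the disc the first translate of \<open>H\<close> is therefore
    close to \<open>1\<close> and the last close to \<open>0\<close>.\<close>
  define t where "t j = real j * d - R - d" for j
  define R' where "R' = R + \<bar>t m\<bar> + \<bar>t 0\<bar>"
  define e where "e = 1 / (16 * real m)"
  have e: "e > 0" using m0 by (simp add: e_def)
  obtain H :: "complex poly" where
    H1: "\<And>z. cmod z \<le> R' \<Longrightarrow> Re z \<ge> d \<Longrightarrow> cmod (poly H z - 1) < e" and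
    H0: "\<And>z. cmod z \<le> R' \<Longrightarrow> Re z \<le> - d \<Longrightarrow> cmod (poly H z) < e"
    using polynomial_step[OF d e] by blast
  define h where "h j = pcompose H [:- of_real (t j), 1:]" for j
  have h: "poly (h j) z = poly H (z - of_real (t j))" for j z
    by (simp add: h_def poly_pcompose)
  have dom: "cmod (z - of_real (t j)) \<le> R'" if "cmod z \<le> R" "j \<le> m" for z j
  proof -
    have "t 0 \<le> t j" "t j \<le> t m" using that d by (auto simp: t_def intro!: mult_right_mono)
    then have "\<bar>t j\<bar> \<le> \<bar>t m\<bar> + \<bar>t 0\<bar>" by auto
    then show ?thesis
      using norm_triangle_ineq4[of z "of_real (t j)"] that by (simp add: R'_def)
  qed
  \<comment> \<open>The shift exceeds the error \<open>2 * e\<close> of an increment off its strip,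
    so \<open>k j\<close> has nonnegative real part there. All \<open>m\<close> shifts together
    amount to \<open>1 / 4\<close>, against a telescoping sum close to \<open>1\<close>.\<close>
  define c :: complex where "c = of_real (4 * e)"
  define k where "k j = [:c:] - (h j - h (Suc j))" for j
  have "\<exists>B. \<forall>z\<in>cball 0 R. \<forall>j<m. cmod (poly (k j) z) \<le> B"
  proof -
    have "\<exists>B. \<forall>z\<in>cball 0 R. cmod (poly (k j) z) \<le> B" for j
    proof -
      have "compact ((\<lambda>z. poly (k j) z) ` cball 0 R)"
        by (intro compact_continuous_image continuous_intros) auto
      then have "bounded ((\<lambda>z. poly (k j) z) ` cball 0 R)" by (rule compact_imp_bounded)
      then show ?thesis by (simp add: bounded_iff)
    qed
    then obtain B where B: "\<And>j z. z \<in> cball 0 R \<Longrightarrow> cmod (poly (k j) z) \<le> B j" by metis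
    have "cmod (poly (k j) z) \<le> (\<Sum>j<m. \<bar>B j\<bar>)" if "z \<in> cball 0 R" "j < m" for j z
    proof -
      have "cmod (poly (k j) z) \<le> \<bar>B j\<bar>" using B[OF that(1), of j] by simp
      also have "\<dots> \<le> (\<Sum>j<m. \<bar>B j\<bar>)" using that(2) by (intro member_le_sum) auto
      finally show ?thesis .
    qed
    then show ?thesis by blast
  qed
  then obtain B0 where B0: "\<And>j z. j < m \<Longrightarrow> cmod z \<le> R \<Longrightarrow> cmod (poly (k j) z) \<le> B0"
    by (metis mem_cball_0)
  define B where "B = max 1 B0"
  have B: "\<And>j z. j < m \<Longrightarrow> cmod z \<le> R \<Longrightarrow> cmod (poly (k j) z) \<le> B" "B \<ge> 1"
    using B0 by (force simp: B_def)+
  \<comment> \<open>With this size the quadratic errors sum to \<open>s / 4\<close>, half of the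
    linear gain \<open>s / 2\<close>; also \<open>s * B \<le> 1 / 2\<close> keeps \<open>g j\<close>
    away from \<open>0\<close>.\<close>
  define s where "s = 1 / (2 * real m * B\<^sup>2)"
  have s: "s > 0" using m0 B by (simp add: s_def)
  have sB: "s * B \<le> 1 / 2"
  proof -
    have "s * B = 1 / (2 * (real m * B))" using B(2) by (simp add: s_def power2_eq_square)
    also have "\<dots> \<le> 1 / (2 * (1 * 1))"
      using m0 B(2) by (intro divide_left_mono mult_mono) auto
    finally show ?thesis by simp
  qed
  define g where "g j = 1 + smult (of_real s) (k j)" for j
  have g: "poly (g j) z = 1 + of_real s * poly (k j) z" for j z by (simp add: g_def)
  have sk: "cmod (of_real s * poly (k j) z) \<le> 1 / 2" if "j < m" "cmod z \<le> R" for j z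
  proof -
    have "cmod (of_real s * poly (k j) z) \<le> s * B"
      using s B(1)[OF that] by (simp add: norm_mult)
    then show ?thesis using sB by simp
  qed
  show thesis
  proof (rule that[of m "s / 4" g t])
    show "m > 0" "s / 4 > 0" using m0 s by auto
  next
    fix j z assume jz: "j < m" "cmod z \<le> R"
    show "poly (g j) z \<noteq> 0"
    proof
      assume "poly (g j) z = 0"
      then have "of_real s * poly (k j) z = - 1" by (simp add: g eq_neg_iff_add_eq_0 add.commute)
      then show False using sk[OF jz] by simp
    qed
  next
    fix j z assume jz: "j < m" "cmod z \<le> R" and off: "\<bar>Re z - t j\<bar> > \<delta>"
    have t: "t (Suc j) = t j + d" by (simp add: t_def algebra_simps)
    have d1: "cmod (z - of_real (t j)) \<le> R'" "cmod (z - of_real (t (Suc j))) \<le> R'"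
      using dom[of z j] dom[of z "Suc j"] jz by auto
    have "cmod (poly (h j) z - poly (h (Suc j)) z) \<le> 2 * e"
    proof (cases "Re z \<ge> t j")
      case True
      then have "cmod (poly (h j) z - 1) < e" "cmod (poly (h (Suc j)) z - 1) < e"
        using H1 d1 off t \<delta> unfolding h by (auto simp: d_def)
      then show ?thesis
        using norm_triangle_ineq4[of "poly (h j) z - 1" "poly (h (Suc j)) z - 1"] by simp
    next
      case False
      then have "cmod (poly (h j) z) < e" "cmod (poly (h (Suc j)) z) < e"
        using H0 d1 off t \<delta> unfolding h by (auto simp: d_def)
      then show ?thesis
        using norm_triangle_ineq4[of "poly (h j) z" "poly (h (Suc j)) z"] by simp
    qed
    then have "Re (poly (h j) z - poly (h (Suc j)) z) \<le> 2 * e"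
      using complex_Re_le_cmod order_trans by blast
    then have "Re (poly (k j) z) \<ge> 0" using e by (simp add: k_def c_def)
    then have "1 \<le> Re (poly (g j) z)" using s by (simp add: g)
    then show "1 \<le> cmod (poly (g j) z)" using complex_Re_le_cmod order_trans by blast
  next
    fix z assume z: "cmod z \<le> R"
    have ne: "1 + of_real s * poly (k j) z \<noteq> 0" if "j < m" for j
    proof
      assume "1 + of_real s * poly (k j) z = 0"
      then have "of_real s * poly (k j) z = - 1" by (simp add: eq_neg_iff_add_eq_0 add.commute)
      then show False using sk[OF that z] by simp
    qed
    have "ln (cmod (poly (g j) z)) \<le> s * Re (poly (k j) z) + (s * B)\<^sup>2 / 2" if "j < m" for j
    proof -
      have "cmod (of_real s * poly (k j) z) \<le> s * B"
        using s B(1)[OF that z] by (simp add: norm_mult)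
      then have "(cmod (of_real s * poly (k j) z))\<^sup>2 \<le> (s * B)\<^sup>2"
        by (intro power_mono) auto
      then show ?thesis
        using ln_cmod_one_plus_le[OF ne[OF that]] by (simp add: g)
    qed
    then have "(\<Sum>j<m. ln (cmod (poly (g j) z))) \<le> (\<Sum>j<m. s * Re (poly (k j) z) + (s * B)\<^sup>2 / 2)"
      by (intro sum_mono) auto
    also have "\<dots> = s * (\<Sum>j<m. Re (poly (k j) z)) + real m * ((s * B)\<^sup>2 / 2)"
      by (simp add: sum.distrib sum_distrib_left)
    also have "(\<Sum>j<m. Re (poly (k j) z)) = real m * (4 * e) - Re (poly (h 0) z - poly (h m) z)"
    proof -
      have "(\<Sum>j<m. Re (poly (k j) z))
          = (\<Sum>j<m. 4 * e) - (\<Sum>j<m. Re (poly (h j) z) - Re (poly (h (Suc j)) z))"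
        unfolding sum_subtractf[symmetric] by (intro sum.cong refl) (simp add: k_def c_def)
      also have "(\<Sum>j<m. Re (poly (h j) z) - Re (poly (h (Suc j)) z)) = Re (poly (h 0) z) - Re (poly (h m) z)"
        by (rule sum_lessThan_telescope')
      finally show ?thesis by simp
    qed
    also have "real m * (4 * e) - Re (poly (h 0) z - poly (h m) z) \<le> - (1 / 2)"
    proof -
      have z': "\<bar>Re z\<bar> \<le> R" using abs_Re_le_cmod[of z] z by simp
      have "cmod (poly (h 0) z - 1) < e" "cmod (poly (h m) z) < e"
        using H1[of "z - of_real (t 0)"] H0[of "z - of_real (t m)"] dom[OF z, of 0] dom[OF z, of m] z' md
        unfolding h by (auto simp: t_def)
      then have "cmod ((poly (h 0) z - 1) - poly (h m) z) \<le> 2 * e"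
        using norm_triangle_ineq4[of "poly (h 0) z - 1" "poly (h m) z"] by simp
      then have "\<bar>Re ((poly (h 0) z - 1) - poly (h m) z)\<bar> \<le> 2 * e"
        using abs_Re_le_cmod order_trans by blast
      moreover have "real m * (4 * e) = 1 / 4" using m0 by (simp add: e_def)
      moreover have "2 * e \<le> 1 / 8" using m0 by (simp add: e_def field_simps)
      ultimately show ?thesis by simp
    qed
    also have "real m * ((s * B)\<^sup>2 / 2) = s / 4"
      using m0 B(2) by (simp add: s_def power2_eq_square field_simps)
    finally show "(\<Sum>j<m. ln (cmod (poly (g j) z))) \<le> - (s / 4)"
      using s by simp
  qed
qed

section \<open>Logarithmic energy of measures and of configurations\<close>

lemma integral_enn2real:
  assumes [measurable]: "f \<in> borel_measurable M" and fin: "(\<integral>\<^sup>+ x. f x \<partial>M) \<noteq> \<infinity>"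
  shows "integrable M (\<lambda>x. enn2real (f x))" (is ?int)
    and "(\<integral> x. enn2real (f x) \<partial>M) = enn2real (\<integral>\<^sup>+ x. f x \<partial>M)" (is ?eq)
proof -
  have "AE x in M. f x \<noteq> \<infinity>" using nn_integral_noteq_infinite[of f M] fin by auto
  then have ae: "AE x in M. f x = ennreal (enn2real (f x))"
    by eventually_elim (simp add: less_top)
  then have eq: "(\<integral>\<^sup>+ x. f x \<partial>M) = (\<integral>\<^sup>+ x. ennreal (enn2real (f x)) \<partial>M)"
    by (rule nn_integral_cong_AE)
  show ?int
    using fin unfolding eq by (intro integrableI_nonneg) (auto simp: less_top)
  show ?eq
    by (subst integral_eq_nn_integral) (auto simp: eq[symmetric])
qed

text \<open>Passes from extended real values to Bochner integrals; \<open>U\<close> is minus the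
  logarithmic potential of \<open>\<nu>\<close>. Distances in \<open>K\<close> are bounded, so the
  subtracted part of the energy is finite and the bound makes the other part finite. The infinite
  value of the kernel on the diagonal then forces almost every point to have measure zero.\<close>

lemma log_energy_less_imp:
  fixes \<nu> :: "complex measure"
  assumes "\<nu> \<in> borel_probs_on K" "closed K" "K \<subseteq> cball 0 R" "log_energy \<nu> < ereal \<eta>"
  obtains U :: "complex \<Rightarrow> real" where
    "AE z in \<nu>. (AE w in \<nu>. w \<noteq> z) \<and> integrable \<nu> (\<lambda>w. ln (dist z w)) \<and> U z = (\<integral> w. ln (dist z w) \<partial>\<nu>)"
    "integrable \<nu> U" "(\<integral> z. U z \<partial>\<nu>) > - \<eta>"
proof -
  interpret prob_space \<nu> using assms(1) by (simp add: borel_probs_on_def)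
  have [measurable_cong]: "sets \<nu> = sets borel" and K1: "emeasure \<nu> K = 1"
    using assms(1) by (auto simp: borel_probs_on_def)
  have [measurable]: "K \<in> sets borel" using assms(2) by simp
  have inK: "AE z in \<nu>. z \<in> K"
    by (rule AE_in_set_eq_1[THEN iffD2]) (auto simp: measure_def K1)
  define kp where "kp z w = e2ennreal (log_kernel z w)" for z w
  define kn where "kn z w = e2ennreal (- log_kernel z w)" for z w
  have kn_eq: "kn z w = ennreal (ln (dist z w))" for z w
    by (simp add: kn_def log_kernel_def e2ennreal_neg)
  have kp_eq: "kp z w = (if z = w then \<infinity> else ennreal (- ln (dist z w)))" for z w
    by (simp add: kp_def log_kernel_def)
  have kp_m [measurable]: "(\<lambda>x. kp (fst x) (snd x)) \<in> borel_measurable (borel \<Otimes>\<^sub>M borel)"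
    unfolding kp_eq by measurable
  have kn_m [measurable]: "(\<lambda>x. kn (fst x) (snd x)) \<in> borel_measurable (borel \<Otimes>\<^sub>M borel)"
    unfolding kn_eq by measurable
  define Ap where "Ap z = (\<integral>\<^sup>+ w. kp z w \<partial>\<nu>)" for z
  define An where "An z = (\<integral>\<^sup>+ w. kn z w \<partial>\<nu>)" for z
  have Ap_m [measurable]: "Ap \<in> borel_measurable \<nu>"
    unfolding Ap_def by measurable
  have An_m [measurable]: "An \<in> borel_measurable \<nu>"
    unfolding An_def by measurable
  define A where "A = (\<integral>\<^sup>+ z. Ap z \<partial>\<nu>)"
  define B where "B = (\<integral>\<^sup>+ z. An z \<partial>\<nu>)"
  have en: "log_energy \<nu> = enn2ereal A - enn2ereal B"
    by (simp add: log_energy_def A_def B_def Ap_def An_def kp_def kn_def)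
  have kn_le: "kn z w \<le> ennreal (2 * \<bar>R\<bar>)" if "z \<in> K" "w \<in> K" for z w
  proof (cases "z = w")
    case True
    then show ?thesis by (simp add: kn_eq)
  next
    case False
    have "dist z w \<le> 2 * \<bar>R\<bar>"
    proof -
      have "cmod z \<le> R" "cmod w \<le> R" using that assms(3) by auto
      then show ?thesis using norm_triangle_ineq4[of z w] by (simp add: dist_norm)
    qed
    moreover have "ln (dist z w) \<le> dist z w" using False by (intro less_imp_le ln_less_self) simp
    ultimately show ?thesis unfolding kn_eq by (intro ennreal_leI) simp
  qed
  have An_le: "An z \<le> ennreal (2 * \<bar>R\<bar>)" if "z \<in> K" for z
  proof -
    have "An z \<le> (\<integral>\<^sup>+ w. ennreal (2 * \<bar>R\<bar>) \<partial>\<nu>)"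
      unfolding An_def using inK by (intro nn_integral_mono_AE) (auto elim!: eventually_mono kn_le[OF that])
    then show ?thesis by (simp add: emeasure_space_1)
  qed
  have "B \<le> (\<integral>\<^sup>+ z. ennreal (2 * \<bar>R\<bar>) \<partial>\<nu>)"
    unfolding B_def using inK by (intro nn_integral_mono_AE) (auto elim!: eventually_mono An_le)
  then have "B \<le> ennreal (2 * \<bar>R\<bar>)" by (simp add: emeasure_space_1)
  then have B: "B \<noteq> \<infinity>" using le_less_trans[OF _ ennreal_less_top] by fastforce
  then obtain b where b: "b \<ge> 0" "B = ennreal b" by (cases B) auto
  \<comment> \<open>Otherwise the energy, infinity minus the finite \<open>B\<close>, would be
    infinite.\<close>
  have A: "A \<noteq> \<infinity>"
    using assms(4) b by (auto simp: en)
  then obtain a where a: "a \<ge> 0" "A = ennreal a" by (cases A) auto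
  have ab: "a - b < \<eta>"
    using assms(4) a b by (simp add: en enn2ereal_ennreal)
  define U where "U z = enn2real (An z) - enn2real (Ap z)" for z
  have iA: "integrable \<nu> (\<lambda>z. enn2real (Ap z))" "(\<integral> z. enn2real (Ap z) \<partial>\<nu>) = a"
    using integral_enn2real[of Ap \<nu>] A a by (auto simp: A_def[symmetric])
  have iB: "integrable \<nu> (\<lambda>z. enn2real (An z))" "(\<integral> z. enn2real (An z) \<partial>\<nu>) = b"
    using integral_enn2real[of An \<nu>] B b by (auto simp: B_def[symmetric])
  show thesis
  proof (rule that)
    show "integrable \<nu> U" unfolding U_def using iA iB by simp
    show "(\<integral> z. U z \<partial>\<nu>) > - \<eta>" unfolding U_def using iA iB ab by simp
    have "AE z in \<nu>. Ap z \<noteq> \<infinity>"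
      using nn_integral_noteq_infinite[of Ap \<nu>] A by (auto simp: A_def)
    with inK show "AE z in \<nu>. (AE w in \<nu>. w \<noteq> z) \<and> integrable \<nu> (\<lambda>w. ln (dist z w)) \<and>
        U z = (\<integral> w. ln (dist z w) \<partial>\<nu>)"
    proof eventually_elim
      fix z assume z: "z \<in> K" "Ap z \<noteq> \<infinity>"
      have [measurable]: "(\<lambda>w. kp z w) \<in> borel_measurable \<nu>" "(\<lambda>w. kn z w) \<in> borel_measurable \<nu>"
        unfolding kp_eq kn_eq by measurable
      have "AE w in \<nu>. kp z w \<noteq> \<infinity>"
        using nn_integral_noteq_infinite[of "kp z" \<nu>] z by (auto simp: Ap_def)
      then have ne: "AE w in \<nu>. w \<noteq> z"
        by eventually_elim (auto simp: kp_eq)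
      have 1: "(\<integral>\<^sup>+ w. ennreal (- ln (dist z w)) \<partial>\<nu>) = Ap z"
        unfolding Ap_def using ne by (intro nn_integral_cong_AE) (auto elim!: eventually_mono simp: kp_eq)
      have 2: "(\<integral>\<^sup>+ w. ennreal (ln (dist z w)) \<partial>\<nu>) = An z"
        by (simp add: An_def kn_eq)
      have "An z \<noteq> \<infinity>" using le_less_trans[OF An_le[OF z(1)] ennreal_less_top] by simp
      then have int: "integrable \<nu> (\<lambda>w. ln (dist z w))"
        using z(2) by (intro real_integrable_def[THEN iffD2]) (auto simp: 1 2)
      then have "(\<integral> w. ln (dist z w) \<partial>\<nu>) = U z"
        by (simp add: real_lebesgue_integral_def 1 2 U_def)
      then show "(AE w in \<nu>. w \<noteq> z) \<and> integrable \<nu> (\<lambda>w. ln (dist z w)) \<and>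
        U z = (\<integral> w. ln (dist z w) \<partial>\<nu>)"
        using ne int by simp
    qed
  qed
qed

text \<open>Every unordered pair counts twice. With the weight \<open>2 N ln |g|\<close> the terms
  involving one point are then twice the logarithm of \<open>|p'| / |g| ^ N\<close> at that point,
  for the monic \<open>p\<close> with these zeros.\<close>

definition weighted_energy :: "nat \<Rightarrow> (complex \<Rightarrow> real) \<Rightarrow> (nat \<Rightarrow> complex) \<Rightarrow> real" where
  "weighted_energy n f z =
     (\<Sum>i<n. \<Sum>j\<in>{..<n}-{i}. ln (dist (z i) (z j))) - (\<Sum>i<n. f (z i))"

lemma weighted_energy_Suc:
  "weighted_energy (Suc k) f (z(k := x)) =
     weighted_energy k f z + 2 * (\<Sum>i<k. ln (dist (z i) x)) - f x"
proof -
  let ?z = "z(k := x)"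
  have A: "{..<Suc k} - {i} = insert k ({..<k} - {i})" if "i < k" for i
    using that by auto
  have "(\<Sum>i<Suc k. \<Sum>j\<in>{..<Suc k}-{i}. ln (dist (?z i) (?z j)))
      = (\<Sum>i<k. \<Sum>j\<in>{..<Suc k}-{i}. ln (dist (?z i) (?z j))) + (\<Sum>j<k. ln (dist x (z j)))"
    by (simp add: lessThan_Suc)
  also have "(\<Sum>i<k. \<Sum>j\<in>{..<Suc k}-{i}. ln (dist (?z i) (?z j)))
      = (\<Sum>i<k. ln (dist (z i) x) + (\<Sum>j\<in>{..<k}-{i}. ln (dist (z i) (z j))))"
    by (intro sum.cong refl) (simp add: A)
  finally show ?thesis
    by (simp add: weighted_energy_def sum.distrib dist_commute)
qed

lemma (in prob_space) exists_ge_expectation: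
  fixes h :: "'a \<Rightarrow> real"
  assumes "integrable M h" "AE x in M. P x"
  shows "\<exists>x. P x \<and> h x \<ge> expectation h"
proof (rule ccontr)
  assume "\<nexists>x. P x \<and> h x \<ge> expectation h"
  then have "AE x in M. h x < expectation h"
    using assms(2) by (auto elim!: eventually_mono simp: not_le)
  then have "expectation h < expectation (\<lambda>_. expectation h)"
    using assms(1) by (intro integral_less_AE_space) (auto simp: emeasure_space_1)
  then show False by (simp add: prob_space)
qed

text \<open>
  The points are chosen one after the other, never decreasing the expected energy of the completion
  of the configuration by independent \<open>\<nu>\<close>-random points.
\<close>
lemma exists_configuration:
  assumes \<nu>: "\<nu> \<in> borel_probs_on K" "closed K" "K \<subseteq> cball 0 R" "log_energy \<nu> < ereal \<eta>"
    and "\<eta> \<ge> 0" and f: "integrable \<nu> f"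
  shows "\<exists>z. (\<forall>i<n. z i \<in> K) \<and> inj_on z {..<n} \<and>
    weighted_energy n f z \<ge> - (real n)\<^sup>2 * \<eta> - real n * (\<integral> x. f x \<partial>\<nu>)"
proof -
  interpret prob_space \<nu> using \<nu>(1) by (simp add: borel_probs_on_def)
  obtain U where U:
    "AE z in \<nu>. (AE w in \<nu>. w \<noteq> z) \<and> integrable \<nu> (\<lambda>w. ln (dist z w)) \<and> U z = (\<integral> w. ln (dist z w) \<partial>\<nu>)"
    and Ui: "integrable \<nu> U" "(\<integral> z. U z \<partial>\<nu>) > - \<eta>"
    using log_energy_less_imp[OF \<nu>] by blast
  \<comment> \<open>The points at which the potential is finite and given by \<open>U\<close>, and
    which \<open>\<nu>\<close> does not charge.\<close>
  define S where "S = {z\<in>K. (AE w in \<nu>. w \<noteq> z) \<and> integrable \<nu> (\<lambda>w. ln (dist z w)) \<and>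
    U z = (\<integral> w. ln (dist z w) \<partial>\<nu>)}"
  have [measurable_cong]: "sets \<nu> = sets borel" and K1: "emeasure \<nu> K = 1"
    using \<nu>(1) by (auto simp: borel_probs_on_def)
  have "K \<in> sets \<nu>" using \<nu>(2) by (simp add: \<open>sets \<nu> = sets borel\<close>)
  then have inK: "AE z in \<nu>. z \<in> K"
    by (intro AE_in_set_eq_1[THEN iffD2]) (auto simp: measure_def K1)
  have inS: "AE z in \<nu>. z \<in> S"
    using U inK by eventually_elim (simp add: S_def)
  define I where "I = (\<integral> z. U z \<partial>\<nu>)"
  define F where "F = (\<integral> x. f x \<partial>\<nu>)"
  \<comment> \<open>The left side is the expected energy when the remaining \<open>n - k\<close>
    points are independent with law \<open>\<nu>\<close>: mixed pairs contribute
    \<open>U (z i)\<close>, random pairs contribute \<open>I\<close>, weights contribute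
    \<open>F\<close>. The right side is its value for \<open>k = 0\<close>.\<close>
  have "k \<le> n \<Longrightarrow> \<exists>z. (\<forall>i<k. z i \<in> S) \<and> inj_on z {..<k} \<and>
    weighted_energy k f z + 2 * (real n - real k) * (\<Sum>i<k. U (z i))
      + (real n - real k) * (real n - real k - 1) * I - (real n - real k) * F
    \<ge> real n * (real n - 1) * I - real n * F" for k
  proof (induction k)
    case 0
    then show ?case by (auto simp: weighted_energy_def)
  next
    case (Suc k)
    then obtain z where z: "\<forall>i<k. z i \<in> S" "inj_on z {..<k}" and
      ge: "weighted_energy k f z + 2 * (real n - real k) * (\<Sum>i<k. U (z i))
      + (real n - real k) * (real n - real k - 1) * I - (real n - real k) * F
    \<ge> real n * (real n - 1) * I - real n * F" by auto
    \<comment> \<open>The part of the expected energy that depends on the next point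
      \<open>x\<close>, the later points still being random.\<close>
    define h where "h x = 2 * (\<Sum>i<k. ln (dist (z i) x)) + 2 * (real n - real k - 1) * U x - f x" for x
    have int: "integrable \<nu> (\<lambda>x. ln (dist (z i) x))" "(\<integral> x. ln (dist (z i) x) \<partial>\<nu>) = U (z i)" if "i < k" for i
      using z(1) that by (auto simp: S_def)
    have "has_bochner_integral \<nu> h (2 * (\<Sum>i<k. U (z i)) + 2 * (real n - real k - 1) * I - F)"
      unfolding h_def using int Ui f
      by (intro has_bochner_integral_diff has_bochner_integral_add has_bochner_integral_mult_right
          has_bochner_integral_sum) (auto simp: has_bochner_integral_iff I_def F_def)
    then have hi: "integrable \<nu> h"
      and he: "(\<integral> x. h x \<partial>\<nu>) = 2 * (\<Sum>i<k. U (z i)) + 2 * (real n - real k - 1) * I - F"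
      by (auto simp: has_bochner_integral_iff)
    \<comment> \<open>Earlier points lie in \<open>S\<close> and so are null; the next point can
      avoid them.\<close>
    have "AE x in \<nu>. \<forall>i\<in>{..<k}. x \<noteq> z i"
      using z(1) by (intro AE_finite_allI) (auto simp: S_def)
    with inS have "AE x in \<nu>. x \<in> S \<and> (\<forall>i<k. x \<noteq> z i)"
      by eventually_elim auto
    from exists_ge_expectation[OF hi this]
    obtain x where x: "x \<in> S" "\<forall>i<k. x \<noteq> z i" "h x \<ge> (\<integral> x. h x \<partial>\<nu>)" by blast
    have hx: "h x \<ge> 2 * (\<Sum>i<k. U (z i)) + 2 * (real n - real k - 1) * I - F"
      using x(3) he by simp
    show ?case
    proof (intro exI conjI)
      show "\<forall>i<Suc k. (z(k := x)) i \<in> S" using z x by (auto simp: less_Suc_eq)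
      show "inj_on (z(k := x)) {..<Suc k}"
        using z x by (auto simp: inj_on_def less_Suc_eq)
      have sU: "(\<Sum>i<Suc k. U ((z(k := x)) i)) = (\<Sum>i<k. U (z i)) + U x" by simp
      show "weighted_energy (Suc k) f (z(k := x)) + 2 * (real n - real (Suc k)) * (\<Sum>i<Suc k. U ((z(k := x)) i))
        + (real n - real (Suc k)) * (real n - real (Suc k) - 1) * I - (real n - real (Suc k)) * F
        \<ge> real n * (real n - 1) * I - real n * F"
        unfolding weighted_energy_Suc sU using ge hx unfolding h_def
        by (simp add: algebra_simps)
    qed
  qed
  from this[of n] obtain z where z: "\<forall>i<n. z i \<in> S" "inj_on z {..<n}"
    "weighted_energy n f z \<ge> real n * (real n - 1) * I - real n * F" by auto
  have "real n * (real n - 1) * I \<ge> - (real n)\<^sup>2 * \<eta>"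
  proof -
    have "real n * (real n - 1) \<ge> 0" by (cases n) auto
    then have "real n * (real n - 1) * I \<ge> real n * (real n - 1) * (- \<eta>)"
      using Ui(2) by (intro mult_left_mono) (auto simp: I_def)
    moreover have "real n * \<eta> \<ge> 0" using \<open>\<eta> \<ge> 0\<close> by simp
    ultimately show ?thesis by (simp add: algebra_simps power2_eq_square)
  qed
  then show ?thesis
    using z by (intro exI[of _ z]) (auto simp: S_def F_def)
qed

section \<open>Segments in the closure of a domain with regular boundary\<close>

text \<open>Locally the domain lies above a graph, so upward shifts in the rotated coordinates stay
  inside it. Compactness of the closure makes the length uniform.\<close>

lemma C2_boundary_segments:
  assumes "open \<Omega>" "bounded \<Omega>" "C2_boundary \<Omega>"
  obtains \<tau> :: real where "\<tau> > 0"
    "\<And>w. w \<in> closure \<Omega> \<Longrightarrow> \<exists>u. cmod u = 1 \<and> (\<forall>s\<in>{0..\<tau>}. w + of_real s * u \<in> closure \<Omega>)"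
proof -
  have "\<exists>r>0. \<exists>u. cmod u = 1 \<and>
      (\<forall>w\<in>closure \<Omega> \<inter> ball p r. \<forall>s\<in>{0..r}. w + of_real s * u \<in> closure \<Omega>)"
    if p: "p \<in> closure \<Omega>" for p
  proof (cases "p \<in> \<Omega>")
    case True
    then obtain e where e: "e > 0" "ball p e \<subseteq> \<Omega>"
      using assms(1) open_contains_ball by blast
    have "w + of_real s * 1 \<in> closure \<Omega>" if "w \<in> ball p (e / 2)" "s \<in> {0..e / 2}" for w s
    proof -
      have "dist p (w + of_real s) \<le> dist p w + dist w (w + of_real s)" by (rule dist_triangle)
      also have "\<dots> < e" using that by (simp add: dist_norm)
      finally have "w + of_real s * 1 \<in> \<Omega>" using e by auto
      then show ?thesis using closure_subset by blast
    qed
    then show ?thesis using e(1) by (intro exI[of _ "e / 2"] conjI exI[of _ 1]) auto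
  next
    case False
    then have "p \<in> frontier \<Omega>" using p assms(1) by (simp add: frontier_def interior_open)
    then obtain r u g where r: "r > 0" "cmod u = 1"
      and eq: "\<Omega> \<inter> ball p r = {z \<in> ball p r. Im (u * z) > g (Re (u * z))}"
      using assms(3) unfolding C2_boundary_def by meson
    \<comment> \<open>The direction that multiplication by \<open>u\<close> turns into the upward
      vertical.\<close>
    define v where "v = \<i> * cnj u"
    have uv: "u * v = \<i>" using complex_norm_square[of u] r(2) by (simp add: v_def mult.left_commute)
    have v: "cmod v = 1" using r(2) by (simp add: v_def norm_mult)
    have "w + of_real s * v \<in> closure \<Omega>"
      if w: "w \<in> closure \<Omega>" "w \<in> ball p (r / 2)" and s: "s \<in> {0..r / 2}" for w s
      unfolding closure_approachable
    proof (intro allI impI)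
      fix e :: real assume "e > 0"
      \<comment> \<open>The graph describes \<open>\<Omega>\<close> and not its closure. So a point
        \<open>w'\<close> of \<open>\<Omega>\<close> close to \<open>w\<close> is shifted instead,
        within the half-radius ball.\<close>
      then have "min e (r / 2 - dist p w) > 0" using w(2) by simp
      then obtain w' where w': "w' \<in> \<Omega>" "dist w' w < min e (r / 2 - dist p w)"
        using w(1) closure_approachable by blast
      have pw': "dist p w' < r / 2"
        using dist_triangle[of p w' w] w'(2) by (simp add: dist_commute)
      then have "w' \<in> \<Omega> \<inter> ball p r" using w'(1) r(1) by simp
      then have gt: "Im (u * w') > g (Re (u * w'))" unfolding eq by simp
      have "u * (w' + of_real s * v) = u * w' + of_real s * (u * v)" by (simp add: algebra_simps)
      then have e': "u * (w' + of_real s * v) = u * w' + of_real s * \<i>" unfolding uv .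
      have "Re (u * (w' + of_real s * v)) = Re (u * w')" "Im (u * (w' + of_real s * v)) = Im (u * w') + s"
        unfolding e' by simp_all
      then have gt': "Im (u * (w' + of_real s * v)) > g (Re (u * (w' + of_real s * v)))"
        using gt s by simp
      have "dist p (w' + of_real s * v) \<le> dist p w' + dist w' (w' + of_real s * v)"
        by (rule dist_triangle)
      also have "\<dots> < r" using pw' s v by (simp add: dist_norm norm_mult)
      finally have "w' + of_real s * v \<in> \<Omega> \<inter> ball p r"
        unfolding eq using gt' by (simp only: mem_ball mem_Collect_eq)
      then show "\<exists>y\<in>\<Omega>. dist y (w + of_real s * v) < e"
        using w'(2) by (intro bexI[of _ "w' + of_real s * v"]) auto
    qed
    then show ?thesis using r(1) v by (intro exI[of _ "r / 2"] conjI exI[of _ v]) auto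
  qed
  then obtain r u where r: "\<And>p. p \<in> closure \<Omega> \<Longrightarrow> r p > 0"
    and u: "\<And>p. p \<in> closure \<Omega> \<Longrightarrow> cmod (u p) = 1"
    and ru: "\<And>p w s. p \<in> closure \<Omega> \<Longrightarrow> w \<in> closure \<Omega> \<Longrightarrow> w \<in> ball p (r p) \<Longrightarrow> s \<in> {0..r p}
      \<Longrightarrow> w + of_real s * u p \<in> closure \<Omega>"
    by (metis IntI)
  have "compact (closure \<Omega>)" using assms(2) by (simp add: compact_closure)
  then obtain C where C: "C \<subseteq> closure \<Omega>" "finite C" "closure \<Omega> \<subseteq> (\<Union>p\<in>C. ball p (r p))"
    by (rule compactE_image[of _ "closure \<Omega>" "\<lambda>p. ball p (r p)"]) (use r in force)+
  \<comment> \<open>The element \<open>1\<close> keeps the minimum meaningful when \<open>C\<close>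
    is empty.\<close>
  define \<tau> where "\<tau> = Min (insert 1 (r ` C))"
  show thesis
  proof (rule that)
    show "\<tau> > 0" using C r unfolding \<tau>_def by (subst Min_gr_iff) auto
    fix w assume w: "w \<in> closure \<Omega>"
    then obtain p where p: "p \<in> C" "w \<in> ball p (r p)" using C(3) by blast
    have "\<tau> \<le> r p" unfolding \<tau>_def using C(2) p(1) by (intro Min_le) auto
    then have "\<forall>s\<in>{0..\<tau>}. w + of_real s * u p \<in> closure \<Omega>"
      using ru[of p w] p C(1) w by auto
    then show "\<exists>u. cmod u = 1 \<and> (\<forall>s\<in>{0..\<tau>}. w + of_real s * u \<in> closure \<Omega>)"
      using u p(1) C(1) by blast
  qed
qed

section \<open>Near-maximisers of the weighted energy\<close>

text \<open>
  With \<open>J\<^sub>N = A - 2 N W\<close>, a near-maximiser \<open>z\<close> of \<open>J\<^sub>N\<close> violating the conclusion has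
  \<open>J\<^sub>2\<^sub>N z = J\<^sub>N z - 2 N W z \<ge> 3 J\<^sub>N z - 2 c\<close>, so that the suprema would triple whenever \<open>N\<close> doubles.
\<close>
lemma near_maximiser_doubling:
  fixes A W :: "'c \<Rightarrow> real" and \<alpha> \<beta> c L N0 :: real
  assumes A: "\<And>z. z \<in> C \<Longrightarrow> A z \<le> \<alpha>" and W: "\<And>z. z \<in> C \<Longrightarrow> \<bar>W z\<bar> \<le> \<beta>"
    and "N0 \<ge> 0" "c \<ge> 0"
    and L: "\<exists>z\<in>C. A z - 2 * N0 * W z \<ge> L"
    and big: "3 ^ k0 * (L - c - 3 / 2) > \<alpha> + 2 * (2 ^ k0 * N0) * \<beta>"
  shows "\<exists>k<k0. \<exists>z\<in>C. (\<forall>z'\<in>C. A z' - 2 * (2 ^ k * N0) * W z' \<le> A z - 2 * (2 ^ k * N0) * W z + 1)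
    \<and> A z - 2 ^ k * N0 * W z > c"
proof (rule ccontr)
  assume neg: "\<not> ?thesis"
  define J where "J N z = A z - 2 * N * W z" for N z
  have bound: "J N z \<le> \<alpha> + 2 * N * \<beta>" if "z \<in> C" "N \<ge> 0" for N z
  proof -
    have "N * (- W z) \<le> N * \<beta>" using W[OF that(1)] that(2) by (intro mult_left_mono) auto
    then show ?thesis using A[OF that(1)] by (simp add: J_def)
  qed
  \<comment> \<open>The supremum need not be attained, so maximisers are only taken up to an error
    of \<open>1\<close>.\<close>
  have ex: "\<exists>z\<in>C. \<forall>z'\<in>C. J N z' \<le> J N z + 1" if "N \<ge> 0" for N
  proof -
    have ne: "J N ` C \<noteq> {}" using L by auto
    have bdd: "bdd_above (J N ` C)" using bound that by (intro bdd_aboveI[of _ "\<alpha> + 2 * N * \<beta>"]) auto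
    obtain z where z: "z \<in> C" "Sup (J N ` C) - 1 < J N z"
      using less_cSupD[OF ne, of "Sup (J N ` C) - 1"] by auto
    then show ?thesis using cSup_upper[OF _ bdd] by (intro bexI[of _ z]) fastforce+
  qed
  define Nk where "Nk k = 2 ^ k * N0" for k :: nat
  have Nk: "Nk k \<ge> 0" for k using assms(3) by (simp add: Nk_def)
  from ex[OF Nk] obtain \<zeta> where \<zeta>: "\<And>k. \<zeta> k \<in> C" "\<And>k z'. z' \<in> C \<Longrightarrow> J (Nk k) z' \<le> J (Nk k) (\<zeta> k) + 1"
    by metis
  have fail: "A (\<zeta> k) - Nk k * W (\<zeta> k) \<le> c" if "k < k0" for k
  proof (rule ccontr)
    assume "\<not> A (\<zeta> k) - Nk k * W (\<zeta> k) \<le> c"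
    then have "\<exists>k<k0. \<exists>z\<in>C. (\<forall>z'\<in>C. J (Nk k) z' \<le> J (Nk k) z + 1) \<and> A z - Nk k * W z > c"
      using \<zeta> that by (meson not_le)
    then show False using neg unfolding J_def Nk_def by blast
  qed
  \<comment> \<open>The recursion is \<open>x |-> 3 x - 2 c - 1\<close>, with fixed point
    \<open>c + 1 / 2\<close>; the excess over it triples. The start \<open>L - 1\<close> accounts
    for the \<open>3 / 2\<close>.\<close>
  have "k \<le> k0 \<Longrightarrow> J (Nk k) (\<zeta> k) - (c + 1 / 2) \<ge> 3 ^ k * (L - c - 3 / 2)" for k
  proof (induction k)
    case 0
    obtain z where "z \<in> C" "J N0 z \<ge> L" using L by (auto simp: J_def)
    then show ?case using \<zeta>(2)[of z 0] by (simp add: Nk_def)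
  next
    case (Suc k)
    have "J (Nk (Suc k)) (\<zeta> (Suc k)) + 1 \<ge> J (Nk (Suc k)) (\<zeta> k)" using \<zeta> by blast
    also have "J (Nk (Suc k)) (\<zeta> k) = J (Nk k) (\<zeta> k) - 2 * (Nk k * W (\<zeta> k))"
      by (simp add: J_def Nk_def algebra_simps)
    finally have "J (Nk (Suc k)) (\<zeta> (Suc k)) + 1 \<ge> 3 * J (Nk k) (\<zeta> k) - 2 * c"
      using fail[of k] Suc.prems by (simp add: J_def)
    moreover have "J (Nk k) (\<zeta> k) - (c + 1 / 2) \<ge> 3 ^ k * (L - c - 3 / 2)" using Suc by simp
    ultimately show ?case by (simp del: right_diff_distrib)
  qed
  from this[of k0] have "J (Nk k0) (\<zeta> k0) \<ge> 3 ^ k0 * (L - c - 3 / 2)" using assms(4) by simp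
  moreover have "J (Nk k0) (\<zeta> k0) \<le> \<alpha> + 2 * Nk k0 * \<beta>" by (rule bound[OF \<zeta>(1) Nk])
  ultimately show False using big by (simp add: Nk_def)
qed

lemma weighted_energy_split:
  assumes i: "i < n"
  shows "weighted_energy n f z =
    2 * (\<Sum>j\<in>{..<n}-{i}. ln (dist (z i) (z j))) - f (z i) +
    ((\<Sum>k\<in>{..<n}-{i}. \<Sum>j\<in>{..<n}-{i}-{k}. ln (dist (z k) (z j))) - (\<Sum>k\<in>{..<n}-{i}. f (z k)))"
proof -
  have "(\<Sum>k<n. \<Sum>j\<in>{..<n}-{k}. ln (dist (z k) (z j)))
      = (\<Sum>j\<in>{..<n}-{i}. ln (dist (z i) (z j))) + (\<Sum>k\<in>{..<n}-{i}. \<Sum>j\<in>{..<n}-{k}. ln (dist (z k) (z j)))"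
    using i by (subst sum.remove[of _ i]) auto
  also have "(\<Sum>k\<in>{..<n}-{i}. \<Sum>j\<in>{..<n}-{k}. ln (dist (z k) (z j)))
      = (\<Sum>k\<in>{..<n}-{i}. ln (dist (z i) (z k)) + (\<Sum>j\<in>{..<n}-{i}-{k}. ln (dist (z k) (z j))))"
  proof (intro sum.cong refl)
    fix k assume k: "k \<in> {..<n} - {i}"
    have "{..<n} - {k} - {i} = {..<n} - {i} - {k}" by auto
    then show "(\<Sum>j\<in>{..<n}-{k}. ln (dist (z k) (z j)))
      = ln (dist (z i) (z k)) + (\<Sum>j\<in>{..<n}-{i}-{k}. ln (dist (z k) (z j)))"
      using k i by (subst sum.remove[of _ i]) (auto simp: dist_commute)
  qed
  moreover have "(\<Sum>k<n. f (z k)) = f (z i) + (\<Sum>k\<in>{..<n}-{i}. f (z k))"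
    using i by (subst sum.remove[of _ i]) auto
  ultimately show ?thesis by (simp add: weighted_energy_def sum.distrib)
qed

lemma weighted_energy_fun_upd:
  assumes i: "i < n"
  shows "weighted_energy n f (z(i := x)) - weighted_energy n f z =
    2 * (\<Sum>j\<in>{..<n}-{i}. ln (dist x (z j))) - f x
    - (2 * (\<Sum>j\<in>{..<n}-{i}. ln (dist (z i) (z j))) - f (z i))"
proof -
  have "(\<Sum>k\<in>{..<n}-{i}. \<Sum>j\<in>{..<n}-{i}-{k}. ln (dist ((z(i := x)) k) ((z(i := x)) j)))
    = (\<Sum>k\<in>{..<n}-{i}. \<Sum>j\<in>{..<n}-{i}-{k}. ln (dist (z k) (z j)))"
    by (intro sum.cong refl) auto
  moreover have "(\<Sum>k\<in>{..<n}-{i}. f ((z(i := x)) k)) = (\<Sum>k\<in>{..<n}-{i}. f (z k))"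
    by (intro sum.cong refl) auto
  moreover have "(\<Sum>j\<in>{..<n}-{i}. ln (dist x ((z(i := x)) j))) = (\<Sum>j\<in>{..<n}-{i}. ln (dist x (z j)))"
    by (intro sum.cong refl) auto
  ultimately show ?thesis
    using weighted_energy_split[OF i, of f "z(i := x)"] weighted_energy_split[OF i, of f z] by simp
qed

section \<open>Products over all nodes but one\<close>

text \<open>Distinctness is imposed because \<open>ln 0 = 0\<close> would let coinciding points
  escape the penalty of the energy.\<close>

definition configurations :: "complex set \<Rightarrow> nat \<Rightarrow> (nat \<Rightarrow> complex) set" where
  "configurations K n = {z. (\<forall>i<n. z i \<in> K) \<and> inj_on z {..<n}}"

text \<open>For \<open>i < n\<close> its value at \<open>z i\<close> is the derivative there of the
  monic polynomial with zeros \<open>z j\<close>.\<close>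

definition deleted_product :: "nat \<Rightarrow> (nat \<Rightarrow> complex) \<Rightarrow> nat \<Rightarrow> complex poly" where
  "deleted_product n z i = (\<Prod>j\<in>{..<n}-{i}. [:- z j, 1:])"

lemma cmod_deleted_product:
  "cmod (poly (deleted_product n z i) x) = (\<Prod>j\<in>{..<n}-{i}. dist x (z j))"
  by (simp add: deleted_product_def poly_prod prod_norm dist_norm)

lemma degree_deleted_product: "degree (deleted_product n z i) \<le> n"
proof -
  have "degree (deleted_product n z i) \<le> (\<Sum>j\<in>{..<n}-{i}. 1)"
    unfolding deleted_product_def
    by (rule order_trans[OF degree_prod_sum_le]) (auto simp: o_def)
  also have "\<dots> \<le> n" using card_mono[of "{..<n}" "{..<n}-{i}"] by simp
  finally show ?thesis .
qed

lemma deleted_product_nonzero: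
  assumes "z \<in> configurations K n" "i < n"
  shows "cmod (poly (deleted_product n z i) (z i)) > 0"
  unfolding cmod_deleted_product using assms
  by (intro prod_pos) (auto simp: configurations_def inj_on_def)

lemma full_product_eq:
  assumes "i < n"
  shows "(\<Prod>j<n. dist x (z j)) = cmod (poly (deleted_product n z i) x) * dist x (z i)"
  unfolding cmod_deleted_product using assms by (subst prod.remove[of _ i]) auto

text \<open>Moving node \<open>i\<close> to \<open>x\<close> gives another configuration unless
  \<open>x\<close> is one of the other nodes, where the left side vanishes. The energy then changes
  by twice the logarithm of the quotient of the two ratios, and it can rise by at most
  \<open>1\<close>.\<close>

lemma near_maximiser_deleted_product_le:
  assumes z: "z \<in> configurations K n"
    and max: "\<And>z'. z' \<in> configurations K n \<Longrightarrow>
      weighted_energy n (\<lambda>x. 2 * real N * ln (cmod (poly g x))) z' \<le>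
      weighted_energy n (\<lambda>x. 2 * real N * ln (cmod (poly g x))) z + 1"
    and g: "\<And>x. x \<in> K \<Longrightarrow> poly g x \<noteq> 0"
    and i: "i < n" and x: "x \<in> K"
  shows "cmod (poly (deleted_product n z i) x) / cmod (poly g x) ^ N \<le>
    exp 1 * (cmod (poly (deleted_product n z i) (z i)) / cmod (poly g (z i)) ^ N)"
proof (cases "poly (deleted_product n z i) x = 0")
  case True
  then show ?thesis by simp
next
  case False
  then have ne: "x \<noteq> z j" if "j \<in> {..<n}-{i}" for j
    using that by (auto simp: deleted_product_def poly_prod)
  have zi: "z i \<in> K" using z i by (auto simp: configurations_def)
  have "z(i := x) \<in> configurations K n"
    using z x ne unfolding configurations_def inj_on_def by (auto split: if_splits)
  from max[OF this]
  have le: "(\<Sum>j\<in>{..<n}-{i}. ln (dist x (z j))) - real N * ln (cmod (poly g x))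
      \<le> (\<Sum>j\<in>{..<n}-{i}. ln (dist (z i) (z j))) - real N * ln (cmod (poly g (z i))) + 1"
    using weighted_energy_fun_upd[OF i, of "\<lambda>x. 2 * real N * ln (cmod (poly g x))" z x] by simp
  have ratio: "cmod (poly (deleted_product n z i) y) / cmod (poly g y) ^ N
      = exp ((\<Sum>j\<in>{..<n}-{i}. ln (dist y (z j))) - real N * ln (cmod (poly g y)))"
    if "\<And>j. j \<in> {..<n}-{i} \<Longrightarrow> y \<noteq> z j" "y \<in> K" for y
  proof -
    have "exp (\<Sum>j\<in>{..<n}-{i}. ln (dist y (z j))) = (\<Prod>j\<in>{..<n}-{i}. dist y (z j))"
      using that(1) by (subst exp_sum) (auto intro!: prod.cong)
    moreover have "exp (real N * ln (cmod (poly g y))) = cmod (poly g y) ^ N"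
      using g[OF that(2)] by (simp add: exp_of_nat_mult)
    ultimately show ?thesis by (simp add: exp_diff cmod_deleted_product)
  qed
  have ne': "z i \<noteq> z j" if "j \<in> {..<n}-{i}" for j
    using z i that by (auto simp: configurations_def inj_on_def)
  have "exp ((\<Sum>j\<in>{..<n}-{i}. ln (dist x (z j))) - real N * ln (cmod (poly g x)))
      \<le> exp 1 * exp ((\<Sum>j\<in>{..<n}-{i}. ln (dist (z i) (z j))) - real N * ln (cmod (poly g (z i))))"
    unfolding exp_add[symmetric] using le by simp
  then show ?thesis
    by (simp only: ratio[OF ne x] ratio[OF ne' zi])
qed

text \<open>
  The value of a deleted product at its own node \<open>z\<^sub>k\<close> is controlled by its values on a segment in
  \<open>K\<close> pointing at \<open>z\<^sub>k\<close>, where deleting another node instead changes the product by a bounded factor.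
\<close>
lemma near_maximiser_comparison:
  fixes \<rho> \<tau> R E :: real
  assumes z: "z \<in> configurations K n"
    and max: "\<And>z'. z' \<in> configurations K n \<Longrightarrow>
      weighted_energy n (\<lambda>x. 2 * real N * ln (cmod (poly g x))) z' \<le>
      weighted_energy n (\<lambda>x. 2 * real N * ln (cmod (poly g x))) z + 1"
    and g: "\<And>x. x \<in> K \<Longrightarrow> poly g x \<noteq> 0"
    and K: "K \<subseteq> cball 0 R" and R: "R > 0"
    and \<tau>: "\<tau> > 0" and \<rho>: "\<rho> > 1"
    and r: "0 < r" "r < \<tau>" "(\<rho> + 1 / \<rho>) / 2 * (\<tau> - r) = \<tau> + r"
    and seg: "cmod u = 1" "\<And>s. s \<in> {0..\<tau>} \<Longrightarrow> z k + of_real s * u \<in> K"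
    and osc: "\<And>s. s \<in> {0..\<tau>} \<Longrightarrow> cmod (poly g (z k + of_real s * u)) \<le> E * cmod (poly g (z k))"
    and i: "i < n" and k: "k < n" and "i \<noteq> k"
  shows "cmod (poly (deleted_product n z k) (z k)) / cmod (poly g (z k)) ^ N \<le>
    (\<rho> ^ n * E ^ N * (exp 1 * (2 * R / r))) *
      (cmod (poly (deleted_product n z i) (z i)) / cmod (poly g (z i)) ^ N)"
proof -
  define M where "M = cmod (poly (deleted_product n z i) (z i)) / cmod (poly g (z i)) ^ N"
  have M0: "M \<ge> 0" by (simp add: M_def)
  have zK: "z i \<in> K" "z k \<in> K" using z i k by (auto simp: configurations_def)
  have gk: "cmod (poly g (z k)) > 0" using g zK by simp
  have "cmod (poly g (z k)) \<le> E * cmod (poly g (z k))" using osc[of 0] \<tau> by simp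
  then have E: "E \<ge> 1" using gk by simp
  \<comment> \<open>Both deleted products divide the same full product, so exchanging them costs
    \<open>dist y (z i) / s\<close>. Starting at \<open>r\<close> instead of \<open>0\<close> keeps
    this factor bounded.\<close>
  have bound: "cmod (poly (deleted_product n z k) (z k + of_real s * u))
      \<le> exp 1 * M * (E * cmod (poly g (z k))) ^ N * (2 * R / r)" if s: "s \<in> {r..\<tau>}" for s
  proof -
    define y where "y = z k + of_real s * u"
    have yK: "y \<in> K" unfolding y_def using s r by (intro seg) auto
    have yk: "dist y (z k) = s" using s r seg(1) by (simp add: y_def dist_norm norm_mult)
    have yi: "dist y (z i) \<le> 2 * R"
    proof -
      have "cmod y \<le> R" "cmod (z i) \<le> R" using K yK zK by auto
      then show ?thesis using norm_triangle_ineq4[of y "z i"] by (simp add: dist_norm)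
    qed
    have gy: "0 < cmod (poly g y)" "cmod (poly g y) \<le> E * cmod (poly g (z k))"
      using g[OF yK] osc[of s] s r by (auto simp: y_def)
    have "cmod (poly (deleted_product n z k) y) * s = cmod (poly (deleted_product n z i) y) * dist y (z i)"
      using full_product_eq[OF i, of y z] full_product_eq[OF k, of y z] yk by simp
    then have "cmod (poly (deleted_product n z k) y) = cmod (poly (deleted_product n z i) y) * (dist y (z i) / s)"
      using s r by (simp add: field_simps)
    also have "\<dots> \<le> (exp 1 * M * cmod (poly g y) ^ N) * (2 * R / r)"
    proof (intro mult_mono)
      show "cmod (poly (deleted_product n z i) y) \<le> exp 1 * M * cmod (poly g y) ^ N"
        using near_maximiser_deleted_product_le[OF z max g i yK] gy
        by (simp add: M_def divide_le_eq)
      show "dist y (z i) / s \<le> 2 * R / r"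
        using yi s r R by (intro frac_le) auto
    qed (use M0 s r in auto)
    also have "\<dots> \<le> exp 1 * M * (E * cmod (poly g (z k))) ^ N * (2 * R / r)"
      using gy M0 R r by (intro mult_right_mono mult_left_mono power_mono) auto
    finally show ?thesis by (simp add: y_def)
  qed
  have "cmod (poly (deleted_product n z k) (z k)) \<le> \<rho> ^ n * (exp 1 * M * (E * cmod (poly g (z k))) ^ N * (2 * R / r))"
  proof -
    \<comment> \<open>Parameters in \<open>[-1, 1]\<close> sweep the part of the segment at distance
      \<open>r\<close> to \<open>\<tau>\<close> from \<open>z k\<close>; the relation between
      \<open>r\<close> and \<open>\<rho>\<close> places \<open>z k\<close> at parameter
      \<open>(\<rho> + 1 / \<rho>) / 2\<close>.\<close>
    define a v where "a = z k + of_real ((\<tau> + r) / 2) * u" and "v = - of_real ((\<tau> - r) / 2) * u"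
    have "cmod (poly (deleted_product n z k) (a + of_real s * v))
      \<le> exp 1 * M * (E * cmod (poly g (z k))) ^ N * (2 * R / r)" if s: "\<bar>s\<bar> \<le> 1" for s :: real
    proof -
      have "a + of_real s * v = z k + of_real ((\<tau> + r) / 2 - s * ((\<tau> - r) / 2)) * u"
        by (simp add: a_def v_def algebra_simps)
      moreover have "\<bar>s * ((\<tau> - r) / 2)\<bar> \<le> 1 * ((\<tau> - r) / 2)"
        unfolding abs_mult using s r by (intro mult_mono) auto
      then have "(\<tau> + r) / 2 - s * ((\<tau> - r) / 2) \<in> {r..\<tau>}"
        by (auto simp: abs_le_iff field_simps)
      ultimately show ?thesis using bound by presburger
    qed
    from poly_growth_off_segment[OF degree_deleted_product \<rho> this]
    have "cmod (poly (deleted_product n z k) (a + of_real ((\<rho> + 1 / \<rho>) / 2) * v))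
      \<le> \<rho> ^ n * (exp 1 * M * (E * cmod (poly g (z k))) ^ N * (2 * R / r))" .
    moreover have "a + of_real ((\<rho> + 1 / \<rho>) / 2) * v = z k"
    proof -
      define X where "X = (\<rho> + 1 / \<rho>) / 2"
      have X: "X * ((\<tau> - r) / 2) = (\<tau> + r) / 2" using r(3) by (simp add: X_def)
      have "a + of_real X * v = z k + of_real ((\<tau> + r) / 2) * u - of_real (X * ((\<tau> - r) / 2)) * u"
        by (simp add: a_def v_def)
      also have "\<dots> = z k" unfolding X by simp
      finally show ?thesis by (simp add: X_def)
    qed
    ultimately show ?thesis by simp
  qed
  then have "cmod (poly (deleted_product n z k) (z k)) / cmod (poly g (z k)) ^ N
     \<le> \<rho> ^ n * (exp 1 * M * (E * cmod (poly g (z k))) ^ N * (2 * R / r)) / cmod (poly g (z k)) ^ N"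
    by (intro divide_right_mono) auto
  also have "\<dots> = \<rho> ^ n * E ^ N * (exp 1 * (2 * R / r)) * M"
    using gk by (simp add: power_mult_distrib)
  finally show ?thesis unfolding M_def .
qed

text \<open>In the Lagrange formula for \<open>g ^ N\<close> the term of node \<open>i\<close> is
  \<open>g (z i) ^ N * p x / ((x - z i) * p' (z i))\<close>. If \<open>x\<close> is farther than
  \<open>n / \<mu>\<close> from all nodes, each term is below \<open>1 / n\<close>, contradicting
  \<open>|g x| \<ge> 1\<close>.\<close>

lemma small_product_imp_near_node:
  assumes z: "z \<in> configurations K n" and n: "n > 0"
    and g: "\<And>x. x \<in> K \<Longrightarrow> poly g x \<noteq> 0"
    and deg: "degree g * N < n" and \<mu>: "\<mu> > 0"
    and lower: "\<And>i. i < n \<Longrightarrow> \<mu> \<le> cmod (poly (deleted_product n z i) (z i)) / cmod (poly g (z i)) ^ N"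
    and small: "(\<Prod>j<n. dist x (z j)) \<le> 1" and large: "cmod (poly g x) \<ge> 1"
  shows "\<exists>i<n. dist x (z i) \<le> real n / \<mu>"
proof (rule ccontr)
  assume "\<not> ?thesis"
  then have far: "dist x (z i) > real n / \<mu>" if "i < n" for i using that by auto
  have n\<mu>: "real n / \<mu> > 0" using n \<mu> by simp
  have inj: "inj_on z {..<n}" using z by (simp add: configurations_def)
  have "degree (g ^ N) \<le> degree g * N" by (rule degree_power_le)
  then have "degree (g ^ N) < n" using deg by simp
  from lagrange_interpolation[OF inj this, of x]
  have "poly g x ^ N = (\<Sum>i<n. poly g (z i) ^ N * (\<Prod>j\<in>{..<n}-{i}. (x - z j) / (z i - z j)))"
    by (simp add: poly_power)
  then have "cmod (poly g x) ^ N = cmod (\<Sum>i<n. poly g (z i) ^ N * (\<Prod>j\<in>{..<n}-{i}. (x - z j) / (z i - z j)))"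
    by (metis norm_power)
  also have "\<dots> \<le> (\<Sum>i<n. cmod (poly g (z i) ^ N * (\<Prod>j\<in>{..<n}-{i}. (x - z j) / (z i - z j))))"
    by (rule norm_sum)
  also have "\<dots> < (\<Sum>i<n. 1 / real n)"
  proof (rule sum_strict_mono)
    fix i assume "i \<in> {..<n}"
    then have i: "i < n" by simp
    then have "z i \<in> K" using z by (auto simp: configurations_def)
    then have gi: "cmod (poly g (z i)) ^ N > 0" using g by simp
    define P where "P = cmod (poly (deleted_product n z i) (z i))"
    have P: "P > 0" unfolding P_def by (rule deleted_product_nonzero[OF z i])
    have \<mu>P: "\<mu> * cmod (poly g (z i)) ^ N \<le> P"
      using lower[OF i] gi by (simp add: P_def le_divide_eq)
    have d: "dist x (z i) > 0" using far[OF i] n\<mu> by linarith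
    have "cmod (\<Prod>j\<in>{..<n}-{i}. (x - z j) / (z i - z j)) = cmod (poly (deleted_product n z i) x) / P"
      by (simp add: P_def cmod_deleted_product prod_norm[symmetric] norm_divide dist_norm prod_dividef)
    also have "cmod (poly (deleted_product n z i) x) \<le> 1 / dist x (z i)"
      using small full_product_eq[OF i, of x z] d by (simp add: field_simps)
    finally have "cmod (\<Prod>j\<in>{..<n}-{i}. (x - z j) / (z i - z j)) \<le> 1 / dist x (z i) / P"
      using P by (simp add: divide_right_mono)
    then have "cmod (poly g (z i) ^ N * (\<Prod>j\<in>{..<n}-{i}. (x - z j) / (z i - z j)))
        \<le> cmod (poly g (z i)) ^ N * (1 / dist x (z i) / P)"
      unfolding norm_mult norm_power by (intro mult_left_mono) auto
    also have "\<dots> = (1 / dist x (z i)) * (cmod (poly g (z i)) ^ N / P)" by simp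
    also have "\<dots> \<le> (1 / dist x (z i)) * (1 / \<mu>)"
      using \<mu>P P \<mu> d by (intro mult_left_mono) (auto simp: field_simps)
    also have "\<dots> < (1 / (real n / \<mu>)) * (1 / \<mu>)"
      using far[OF i] n\<mu> \<mu> d by (intro mult_strict_right_mono divide_strict_left_mono mult_pos_pos) auto
    also have "\<dots> = 1 / real n" using \<mu> by simp
    finally show "cmod (poly g (z i) ^ N * (\<Prod>j\<in>{..<n}-{i}. (x - z j) / (z i - z j))) < 1 / real n" .
  qed (use n in auto)
  also have "\<dots> = 1" using n by simp
  finally have "cmod (poly g x) ^ N < 1" .
  moreover have "cmod (poly g x) ^ N \<ge> 1" using large by simp
  ultimately show False by simp
qed

section \<open>The area of the lemniscate\<close>

lemma emeasure_complex_cbox: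
  assumes "Re a \<le> Re b" "Im a \<le> Im b"
  shows "emeasure lebesgue (cbox a b) = ennreal ((Re b - Re a) * (Im b - Im a))"
proof -
  have "emeasure lborel (cbox a b) = ennreal (\<Prod>i\<in>Basis. (b - a) \<bullet> i)"
    using assms by (intro emeasure_lborel_cbox) (auto simp: Basis_complex_def)
  then show ?thesis by (simp add: Basis_complex_def)
qed

text \<open>Outside the disc of radius \<open>R\<close> all distances to the zeros are at least
  \<open>2\<close>, so the product exceeds \<open>1\<close>. The rest is covered by a rectangle over
  the strip and by squares of side \<open>2 * s\<close> about the zeros.\<close>

lemma emeasure_lemniscate_le:
  assumes n: "n > 0" and R: "R > 0" and \<delta>: "\<delta> \<ge> 0" and s: "s \<ge> 0"
    and zR: "\<And>i. i < n \<Longrightarrow> cmod (z i) \<le> R - 2"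
    and near: "\<And>x. cmod x \<le> R \<Longrightarrow> \<bar>Re x - t\<bar> > \<delta> \<Longrightarrow> (\<Prod>i<n. dist x (z i)) \<le> 1
      \<Longrightarrow> \<exists>i<n. dist x (z i) \<le> s"
  shows "emeasure lebesgue (lemniscate (\<Prod>i<n. [:- z i, 1:]) 1) \<le> ennreal (4 * \<delta> * R + 4 * real n * s\<^sup>2)"
proof -
  define S where "S = cbox (Complex (t - \<delta>) (- R)) (Complex (t + \<delta>) R)"
  define C where "C i = cbox (z i - Complex s s) (z i + Complex s s)" for i
  have "lemniscate (\<Prod>i<n. [:- z i, 1:]) 1 \<subseteq> S \<union> (\<Union>i<n. C i)"
  proof
    fix x assume "x \<in> lemniscate (\<Prod>i<n. [:- z i, 1:]) 1"
    then have le: "(\<Prod>i<n. dist x (z i)) \<le> 1"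
      by (simp add: lemniscate_def poly_prod prod_norm dist_norm)
    have xR: "cmod x \<le> R"
    proof (rule ccontr)
      assume "\<not> cmod x \<le> R"
      then have "2 \<le> dist x (z i)" if "i < n" for i
        using norm_triangle_ineq2[of x "z i"] zR[OF that] by (simp add: dist_norm)
      then have "(\<Prod>i<n. (2::real)) \<le> (\<Prod>i<n. dist x (z i))" by (intro prod_mono) auto
      moreover have "(2::real) ^ n > 1" using n by (intro one_less_power) auto
      ultimately show False using le by simp
    qed
    show "x \<in> S \<union> (\<Union>i<n. C i)"
    proof (cases "\<bar>Re x - t\<bar> > \<delta>")
      case True
      then obtain i where i: "i < n" "dist x (z i) \<le> s" using near xR le by blast
      then have "\<bar>Re (x - z i)\<bar> \<le> s" "\<bar>Im (x - z i)\<bar> \<le> s"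
        using abs_Re_le_cmod[of "x - z i"] abs_Im_le_cmod[of "x - z i"] by (auto simp: dist_norm)
      then have "x \<in> C i" by (auto simp: C_def in_cbox_complex_iff)
      then show ?thesis using i by blast
    next
      case False
      then have "x \<in> S"
        using abs_Im_le_cmod[of x] xR by (auto simp: S_def in_cbox_complex_iff)
      then show ?thesis by blast
    qed
  qed
  then have "emeasure lebesgue (lemniscate (\<Prod>i<n. [:- z i, 1:]) 1) \<le> emeasure lebesgue (S \<union> (\<Union>i<n. C i))"
    by (intro emeasure_mono) (auto simp: S_def C_def)
  also have "\<dots> \<le> emeasure lebesgue S + (\<Sum>i<n. emeasure lebesgue (C i))"
    by (intro order_trans[OF emeasure_subadditive] add_mono emeasure_subadditive_finite order_refl)
      (auto simp: S_def C_def)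
  also have "emeasure lebesgue S = ennreal (4 * \<delta> * R)"
    unfolding S_def using R \<delta> by (subst emeasure_complex_cbox) (auto simp: algebra_simps)
  also have "(\<Sum>i<n. emeasure lebesgue (C i)) = (\<Sum>i<n. ennreal (4 * s\<^sup>2))"
    using s unfolding C_def
    by (intro sum.cong refl, subst emeasure_complex_cbox) (auto simp: power2_eq_square)
  also have "\<dots> = ennreal (4 * real n * s\<^sup>2)"
    by (simp add: sum_constant ennreal_of_nat_eq_real_of_nat ennreal_mult[symmetric] mult_ac)
  also have "ennreal (4 * \<delta> * R) + ennreal (4 * real n * s\<^sup>2) = ennreal (4 * \<delta> * R + 4 * real n * s\<^sup>2)"
    using \<delta> R by (intro ennreal_plus[symmetric]) auto
  finally show ?thesis .
qed

section \<open>Choice of the parameters and of the degree\<close>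

lemma weighted_energy_eq:
  "weighted_energy n (\<lambda>x. c * f x) z = weighted_energy n (\<lambda>_. 0) z - c * (\<Sum>i<n. f (z i))"
  by (simp add: weighted_energy_def sum_distrib_left)

text \<open>The ratio on the right is \<open>\<bar>p' (z\<^sub>k)\<bar> / \<bar>g (z\<^sub>k)\<bar>\<^sup>N\<close> for the monic \<open>p\<close> with zeros \<open>z\<^sub>i\<close>.\<close>
lemma exists_large_deleted_product:
  assumes z: "z \<in> configurations K n" and n: "n > 0"
    and g: "\<And>x. x \<in> K \<Longrightarrow> poly g x \<noteq> 0"
    and gt: "weighted_energy n (\<lambda>_. 0) z - real N * (\<Sum>i<n. ln (cmod (poly g (z i)))) > c * (real n)\<^sup>2"
  shows "\<exists>k<n. exp (c * real n) \<le> cmod (poly (deleted_product n z k) (z k)) / cmod (poly g (z k)) ^ N"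
proof (rule ccontr)
  assume neg: "\<not> ?thesis"
  have "(\<Sum>j\<in>{..<n}-{i}. ln (dist (z i) (z j))) - real N * ln (cmod (poly g (z i))) \<le> c * real n"
    if i: "i < n" for i
  proof -
    have "z i \<in> K" using z i by (auto simp: configurations_def)
    then have gi: "cmod (poly g (z i)) > 0" using g by simp
    define P where "P = cmod (poly (deleted_product n z i) (z i))"
    have P: "P > 0" unfolding P_def by (rule deleted_product_nonzero[OF z i])
    have "ln P = (\<Sum>j\<in>{..<n}-{i}. ln (dist (z i) (z j)))"
      unfolding P_def cmod_deleted_product using z i
      by (intro ln_prod) (auto simp: configurations_def inj_on_def)
    then have "(\<Sum>j\<in>{..<n}-{i}. ln (dist (z i) (z j))) - real N * ln (cmod (poly g (z i)))
        = ln (P / cmod (poly g (z i)) ^ N)"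
      using gi P by (simp add: ln_div ln_realpow)
    also have "\<dots> \<le> ln (exp (c * real n))"
      using neg i gi P by (intro ln_mono) (auto simp: P_def not_le intro: less_imp_le)
    finally show ?thesis by simp
  qed
  then have "(\<Sum>i<n. (\<Sum>j\<in>{..<n}-{i}. ln (dist (z i) (z j))) - real N * ln (cmod (poly g (z i))))
      \<le> (\<Sum>i<n. c * real n)"
    by (intro sum_mono) auto
  also have "\<dots> = c * (real n)\<^sup>2" by (simp add: power2_eq_square)
  finally show False
    using gt by (simp add: weighted_energy_def sum_subtractf sum_distrib_left)
qed

text \<open>The two demands on the degree: the additive errors of the doubling argument are absorbed
  by a multiple of \<open>n^2\<close>, and the squares about the nodes have small total
  area.\<close>

lemma eventually_square_ge_and_disc_area_le:
  fixes c \<kappa> b \<epsilon> :: real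
  assumes "c > 0" "\<epsilon> > 0"
  shows "\<forall>\<^sub>F n :: nat in sequentially. b \<le> c * (real n)\<^sup>2 \<and>
    4 * real n * (real n / (exp (c * real n) / \<kappa>))\<^sup>2 \<le> \<epsilon>"
proof (rule eventually_conj)
  have "filterlim (\<lambda>n. c * (real n)\<^sup>2) at_top sequentially"
    using assms(1) by real_asymp
  then show "\<forall>\<^sub>F n in sequentially. b \<le> c * (real n)\<^sup>2"
    by (simp add: filterlim_at_top)
  have "(\<lambda>n. 4 * real n * (real n / (exp (c * real n) / \<kappa>))\<^sup>2) \<longlonglongrightarrow> 0"
  proof -
    have "(\<lambda>n. 4 * real n * (real n / exp (c * real n))\<^sup>2) \<longlonglongrightarrow> 0"
      using assms(1) by real_asymp
    then have "(\<lambda>n. \<kappa>\<^sup>2 * (4 * real n * (real n / exp (c * real n))\<^sup>2)) \<longlonglongrightarrow> \<kappa>\<^sup>2 * 0"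
      by (intro tendsto_mult tendsto_const)
    then show ?thesis by (simp add: power_divide power_mult_distrib mult_ac)
  qed
  from order_tendstoD(2)[OF this assms(2)]
  show "\<forall>\<^sub>F n in sequentially. 4 * real n * (real n / (exp (c * real n) / \<kappa>))\<^sup>2 \<le> \<epsilon>"
    by eventually_elim simp
qed

text \<open>Uniform continuity of \<open>ln |g|\<close> on \<open>K\<close>, exponentiated, bounds
  the oscillation of \<open>|g|\<close> by a factor.\<close>

lemma uniformly_continuous_ln_poly:
  assumes K: "compact K" and g: "\<And>x. x \<in> K \<Longrightarrow> poly g x \<noteq> 0" and "e > 0"
  obtains \<tau> :: real where "\<tau> > 0"
    "\<And>x y. x \<in> K \<Longrightarrow> y \<in> K \<Longrightarrow> dist x y < \<tau> \<Longrightarrow> cmod (poly g y) \<le> exp e * cmod (poly g x)"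
proof -
  have "continuous_on K (\<lambda>x. ln (cmod (poly g x)))"
    using g by (intro continuous_intros) auto
  then have "uniformly_continuous_on K (\<lambda>x. ln (cmod (poly g x)))"
    using K compact_uniformly_continuous by blast
  then obtain \<tau> where \<tau>: "\<tau> > 0" "\<And>x y. x \<in> K \<Longrightarrow> y \<in> K \<Longrightarrow> dist y x < \<tau> \<Longrightarrow>
      dist (ln (cmod (poly g y))) (ln (cmod (poly g x))) < e"
    using \<open>e > 0\<close> unfolding uniformly_continuous_on_def by meson
  show thesis
  proof (rule that[OF \<tau>(1)])
    fix x y assume xy: "x \<in> K" "y \<in> K" "dist x y < \<tau>"
    then have "ln (cmod (poly g y)) \<le> e + ln (cmod (poly g x))"
      using \<tau>(2)[of x y] by (simp add: dist_commute dist_real_def abs_less_iff)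
    then have "exp (ln (cmod (poly g y))) \<le> exp (e + ln (cmod (poly g x)))" by simp
    then show "cmod (poly g y) \<le> exp e * cmod (poly g x)"
      using g xy by (simp add: exp_add)
  qed
qed

text \<open>The order of choices matters. The barriers and the constants \<open>B\<close>,
  \<open>d\<close>, \<open>k0\<close>, \<open>D\<close>, \<open>c\<close>, uniform in the barrier,
  precede \<open>\<nu>\<close>, whose energy must be below \<open>c\<close>. Only
  \<open>\<nu>\<close> selects the barrier \<open>g j\<close>; the local scales and a large degree
  come last.\<close>

lemma exists_degree_kappa_le:
  fixes K :: "complex set" and \<epsilon> \<tau>0 :: real
  assumes K: "compact K"
    and \<tau>0: "\<tau>0 > 0"
      "\<And>w. w \<in> K \<Longrightarrow> \<exists>u. cmod u = 1 \<and> (\<forall>s\<in>{0..\<tau>0}. w + of_real s * u \<in> K)"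
    and energy: "\<And>\<eta>. \<eta> > 0 \<Longrightarrow> \<exists>\<nu>\<in>borel_probs_on K. log_energy \<nu> < ereal \<eta>"
    and \<epsilon>: "\<epsilon> > 0"
  shows "\<exists>n\<ge>1. kappa n K 1 \<le> ennreal \<epsilon>"
proof -
  obtain R0 where "\<forall>x\<in>K. cmod x \<le> R0"
    using compact_imp_bounded[OF K] by (auto simp: bounded_iff)
  then have "\<exists>R>0. \<forall>x\<in>K. cmod x \<le> R - 2" by (intro exI[of _ "\<bar>R0\<bar> + 2"]) auto
  then obtain R where R: "R > 0" and KR: "\<And>x. x \<in> K \<Longrightarrow> cmod x \<le> R - 2" by blast
  have KR': "cmod x \<le> R" if "x \<in> K" for x using KR[OF that] by simp
  then have Kball: "K \<subseteq> cball 0 R" by auto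
  \<comment> \<open>Then the strip has area
    \<open>4 * \<delta> * R = \<epsilon> / 2\<close>.\<close>
  define \<delta> where "\<delta> = \<epsilon> / (8 * R)"
  have \<delta>: "\<delta> > 0" using \<epsilon> R by (simp add: \<delta>_def)
  obtain m :: nat and g :: "nat \<Rightarrow> complex poly" and t :: "nat \<Rightarrow> real" and a :: real
    where m: "m > 0" and a: "a > 0"
      and g0: "\<And>j z. j < m \<Longrightarrow> cmod z \<le> R \<Longrightarrow> poly (g j) z \<noteq> 0"
      and g1: "\<And>j z. j < m \<Longrightarrow> cmod z \<le> R \<Longrightarrow> \<bar>Re z - t j\<bar> > \<delta> \<Longrightarrow> cmod (poly (g j) z) \<ge> 1"
      and gs: "\<And>z. cmod z \<le> R \<Longrightarrow> (\<Sum>j<m. ln (cmod (poly (g j) z))) \<le> - a"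
    by (rule polynomial_barriers[OF R \<delta>]) (rule that)
  define f where "f j x = ln (cmod (poly (g j) x))" for j x
  have "\<exists>B. \<forall>x\<in>K. \<bar>f j x\<bar> \<le> B" if "j < m" for j
  proof -
    have "compact (f j ` K)"
      unfolding f_def using g0[OF that KR'] K by (intro compact_continuous_image continuous_intros) auto
    then have "bounded (f j ` K)" by (rule compact_imp_bounded)
    then show ?thesis by (auto simp: bounded_iff)
  qed
  then obtain B0 where B0: "\<And>j x. j < m \<Longrightarrow> x \<in> K \<Longrightarrow> \<bar>f j x\<bar> \<le> B0 j" by metis
  define B where "B = (\<Sum>j<m. \<bar>B0 j\<bar>)"
  have B: "\<bar>f j x\<bar> \<le> B" if "j < m" "x \<in> K" for j x
  proof -
    have "\<bar>f j x\<bar> \<le> \<bar>B0 j\<bar>" using B0[OF that] by simp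
    also have "\<dots> \<le> B" unfolding B_def using that(1) by (intro member_le_sum) auto
    finally show ?thesis .
  qed
  have B_nonneg: "B \<ge> 0" by (simp add: B_def sum_nonneg)
  define d where "d = (\<Sum>j<m. degree (g j))"
  have d: "degree (g j) \<le> d" if "j < m" for j
    unfolding d_def using that by (intro member_le_sum) auto
  define a1 where "a1 = a / real m"
  have a1: "a1 > 0" using a m by (simp add: a1_def)
  \<comment> \<open>After \<open>k0\<close> doublings the tripled gain, compared with the starting
    exponent divided by \<open>2 ^ k0\<close>, must beat the trivial energy bound.\<close>
  obtain k0 where k0: "(2 * R + 2 * B) * (real d + 1) / a1 < (3 / 2 :: real) ^ k0"
    using real_arch_pow[of "3 / 2"] by auto
  \<comment> \<open>With \<open>n = l * D\<close> one has \<open>2 ^ k0 * l * (d + 1) = n\<close>,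
    so all exponents up to \<open>2 ^ k0 * l\<close> keep \<open>g j ^ N\<close> below degree
    \<open>n\<close>.\<close>
  define D where "D = (d + 1) * 2 ^ k0"
  have D: "D > 0" by (simp add: D_def)
  define c where "c = a1 / (4 * real D)"
  have c: "c > 0" using a1 D by (simp add: c_def)
  obtain \<nu> where \<nu>: "\<nu> \<in> borel_probs_on K" "log_energy \<nu> < ereal c"
    using energy[OF c] by blast
  interpret \<nu>: prob_space \<nu> using \<nu>(1) by (simp add: borel_probs_on_def)
  have [measurable_cong]: "sets \<nu> = sets borel" and K1: "emeasure \<nu> K = 1"
    using \<nu>(1) by (auto simp: borel_probs_on_def)
  have "closed K" using K by (rule compact_imp_closed)
  then have "K \<in> sets \<nu>" by (simp add: \<open>sets \<nu> = sets borel\<close>)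
  then have inK: "AE z in \<nu>. z \<in> K"
    by (intro \<nu>.AE_in_set_eq_1[THEN iffD2]) (auto simp: measure_def K1)
  have fi: "integrable \<nu> (f j)" if "j < m" for j
  proof (rule \<nu>.integrable_const_bound[where B = B])
    show "AE x in \<nu>. norm (f j x) \<le> B" using inK by eventually_elim (simp add: B[OF that])
    have "(\<lambda>x. poly (g j) x) \<in> borel_measurable borel"
      by (intro borel_measurable_continuous_onI continuous_intros)
    then show "f j \<in> borel_measurable \<nu>" unfolding f_def by measurable
  qed
  \<comment> \<open>Averaging: the integrals sum to at most \<open>- a = - m * a1\<close>.\<close>
  have "\<exists>j<m. (\<integral> x. f j x \<partial>\<nu>) \<le> - a1"
  proof (rule ccontr)
    assume "\<not> ?thesis"
    then have "(\<Sum>j<m. - a1) < (\<Sum>j<m. (\<integral> x. f j x \<partial>\<nu>))"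
      using m by (intro sum_strict_mono) (auto simp: not_le)
    also have "\<dots> = (\<integral> x. (\<Sum>j<m. f j x) \<partial>\<nu>)"
      using fi by (subst Bochner_Integration.integral_sum) auto
    also have "\<dots> \<le> (\<integral> x. - a \<partial>\<nu>)"
    proof (rule integral_mono_AE)
      show "AE x in \<nu>. (\<Sum>j<m. f j x) \<le> - a"
        using inK by eventually_elim (simp add: f_def gs KR')
    qed (use fi in auto)
    finally show False using m by (simp add: \<nu>.prob_space a1_def)
  qed
  then obtain j where j: "j < m" and fj: "(\<integral> x. f j x \<partial>\<nu>) \<le> - a1" by blast
  have gK: "poly (g j) x \<noteq> 0" if "x \<in> K" for x using g0[OF j KR'[OF that]] .

  obtain \<tau>1 where \<tau>1: "\<tau>1 > 0" "\<And>x y. x \<in> K \<Longrightarrow> y \<in> K \<Longrightarrow> dist x y < \<tau>1 \<Longrightarrow>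
      cmod (poly (g j) y) \<le> exp (c / 4) * cmod (poly (g j) x)"
    using uniformly_continuous_ln_poly[OF K gK, of "c / 4"] c by auto
  define \<tau> where "\<tau> = min \<tau>0 (\<tau>1 / 2)"
  have \<tau>: "0 < \<tau>" "\<tau> \<le> \<tau>0" "\<tau> < \<tau>1" using \<tau>0(1) \<tau>1(1) by (auto simp: \<tau>_def)
  \<comment> \<open>The extrapolation loss \<open>\<rho> ^ n\<close> and the oscillation loss
    \<open>exp (c / 4) ^ N\<close>, with \<open>N \<le> n\<close>, together cost at most
    \<open>exp (c / 2 * n)\<close>, half of the exponent gained.\<close>
  define \<rho> where "\<rho> = exp (c / 4)"
  have \<rho>: "\<rho> > 1" using c by (simp add: \<rho>_def)
  define X where "X = (\<rho> + 1 / \<rho>) / 2"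
  have X: "X > 1"
  proof -
    have "(\<rho> - 1)\<^sup>2 > 0" using \<rho> by simp
    then have "2 * \<rho> < \<rho> * \<rho> + 1" by (simp add: power2_eq_square algebra_simps)
    then show ?thesis using \<rho> by (simp add: X_def field_simps)
  qed
  \<comment> \<open>The solution of \<open>X * (\<tau> - r) = \<tau> + r\<close>.\<close>
  define r where "r = \<tau> * (X - 1) / (X + 1)"
  have r: "0 < r" "r < \<tau>" "X * (\<tau> - r) = \<tau> + r"
    using X \<tau>(1) by (auto simp: r_def field_simps)
  define \<kappa> where "\<kappa> = max 1 (exp 1 * (2 * R / r))"
  have \<kappa>: "\<kappa> \<ge> 1" "exp 1 * (2 * R / r) \<le> \<kappa>" by (auto simp: \<kappa>_def)

  obtain n0 where n0: "\<And>n. n \<ge> n0 \<Longrightarrow> 1 \<le> c / 2 * (real n)\<^sup>2 \<and>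
      4 * real n * (real n / (exp (c / 2 * real n) / \<kappa>))\<^sup>2 \<le> \<epsilon> / 2"
    using eventually_square_ge_and_disc_area_le[of "c / 2" "\<epsilon> / 2" 1 \<kappa>] c \<epsilon> by (auto simp: eventually_sequentially)
  define l where "l = max 1 n0"
  define n where "n = l * D"
  have l: "l \<ge> 1" "l \<ge> n0" by (auto simp: l_def)
  have n: "n \<ge> l" "n > 0" using D l by (auto simp: n_def)
  then have n_large: "1 \<le> c / 2 * (real n)\<^sup>2"
      "4 * real n * (real n / (exp (c / 2 * real n) / \<kappa>))\<^sup>2 \<le> \<epsilon> / 2"
    using n0[of n] l by auto
  have nl: "real l = real n / real D" using D by (simp add: n_def)
  have Nn: "2 ^ k0 * l * (d + 1) = n" by (simp add: n_def D_def algebra_simps)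
  then have Nn': "2 ^ k0 * l \<le> n" by (metis le_add2 mult.right_neutral mult_le_mono2)

  define A where "A = weighted_energy n (\<lambda>_. 0)"
  define W where "W z = (\<Sum>i<n. f j (z i))" for z
  have we: "weighted_energy n (\<lambda>x. 2 * real N * ln (cmod (poly (g j) x))) z = A z - 2 * real N * W z" for N z
    unfolding A_def W_def f_def by (rule weighted_energy_eq)
  have "\<exists>k<k0. \<exists>z\<in>configurations K n.
      (\<forall>z'\<in>configurations K n. A z' - 2 * (2 ^ k * real l) * W z' \<le> A z - 2 * (2 ^ k * real l) * W z + 1)
      \<and> A z - 2 ^ k * real l * W z > c * (real n)\<^sup>2"
  proof (rule near_maximiser_doubling)
    fix z assume z: "z \<in> configurations K n"
    show "A z \<le> (real n)\<^sup>2 * (2 * R)"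
    proof -
      have "(\<Sum>j\<in>{..<n}-{i}. ln (dist (z i) (z j))) \<le> (\<Sum>j\<in>{..<n}. 2 * R)" if i: "i < n" for i
      proof -
        have "ln (dist (z i) (z j)) \<le> 2 * R" if j: "j \<in> {..<n}-{i}" for j
        proof -
          have "z i \<noteq> z j" using z i j by (auto simp: configurations_def inj_on_def)
          then have "ln (dist (z i) (z j)) \<le> dist (z i) (z j)" by (intro less_imp_le ln_less_self) simp
          also have "cmod (z i) \<le> R" "cmod (z j) \<le> R" using KR' z i j by (auto simp: configurations_def)
          then have "dist (z i) (z j) \<le> 2 * R"
            using norm_triangle_ineq4[of "z i" "z j"] by (simp add: dist_norm)
          finally show ?thesis .
        qed
        then have "(\<Sum>j\<in>{..<n}-{i}. ln (dist (z i) (z j))) \<le> (\<Sum>j\<in>{..<n}-{i}. 2 * R)"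
          by (rule sum_mono)
        also have "\<dots> \<le> (\<Sum>j\<in>{..<n}. 2 * R)" using R by (intro sum_mono2) auto
        finally show ?thesis .
      qed
      then have "(\<Sum>i<n. \<Sum>j\<in>{..<n}-{i}. ln (dist (z i) (z j))) \<le> (\<Sum>i<n. \<Sum>j\<in>{..<n}. 2 * R)"
        by (intro sum_mono) auto
      then show ?thesis by (simp add: A_def weighted_energy_def power2_eq_square mult_ac)
    qed
    show "\<bar>W z\<bar> \<le> real n * B"
    proof -
      have "\<bar>W z\<bar> \<le> (\<Sum>i<n. \<bar>f j (z i)\<bar>)" unfolding W_def by (rule sum_abs)
      also have "\<dots> \<le> (\<Sum>i<n. B)" using z B[OF j] by (intro sum_mono) (auto simp: configurations_def)
      finally show ?thesis by simp
    qed
  next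
    \<comment> \<open>Since \<open>l = n / D\<close>, the weight contributes at least
      \<open>2 * l * n * a1 = 8 * c * n^2\<close>, of which the energy of \<open>\<nu>\<close> takes
      at most \<open>c * n^2\<close>.\<close>
    show "\<exists>z\<in>configurations K n. A z - 2 * real l * W z \<ge> (real n)\<^sup>2 * (7 * c)"
    proof -
      have "integrable \<nu> (\<lambda>x. 2 * real l * f j x)" using fi[OF j] by simp
      from exists_configuration[OF \<nu>(1) \<open>closed K\<close> Kball \<nu>(2) less_imp_le[OF c] this, of n]
      obtain z where z: "z \<in> configurations K n" and ge: "weighted_energy n (\<lambda>x. 2 * real l * f j x) z
          \<ge> - (real n)\<^sup>2 * c - real n * (2 * real l * (\<integral> x. f j x \<partial>\<nu>))"
        by (auto simp: configurations_def)
      have "real n * (2 * real l) * (\<integral> x. f j x \<partial>\<nu>) \<le> real n * (2 * real l) * (- a1)"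
        using fj by (intro mult_left_mono) auto
      also have "real n * (2 * real l) * (- a1) = - (real n)\<^sup>2 * (8 * c)"
        by (simp add: nl c_def power2_eq_square)
      finally have "real n * (2 * real l * (\<integral> x. f j x \<partial>\<nu>)) \<le> - (real n)\<^sup>2 * (8 * c)"
        by (simp only: mult.assoc)
      moreover have "weighted_energy n (\<lambda>x. 2 * real l * f j x) z = A z - 2 * real l * W z"
        unfolding A_def W_def by (rule weighted_energy_eq)
      moreover have "- (real n)\<^sup>2 * (8 * c) = - 8 * ((real n)\<^sup>2 * c)"
        "(real n)\<^sup>2 * (7 * c) = 7 * ((real n)\<^sup>2 * c)" "- (real n)\<^sup>2 * c = - ((real n)\<^sup>2 * c)"
        by simp_all
      ultimately have "(real n)\<^sup>2 * (7 * c) \<le> A z - 2 * real l * W z"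
        using ge by linarith
      then show ?thesis using z by blast
    qed
    have D': "real D = (real d + 1) * 2 ^ k0" by (simp add: D_def algebra_simps)
    have n2: "(real n)\<^sup>2 > 0" using n by simp
    \<comment> \<open>As \<open>2 ^ k0 * l \<le> n\<close>, the upper bound is quadratic in
      \<open>n\<close>. The factor \<open>n^2\<close> cancels and the inequality reduces to the
      choice of \<open>k0\<close>.\<close>
    have "(real n)\<^sup>2 * (2 * R) + 2 * (2 ^ k0 * real l) * (real n * B) \<le> (real n)\<^sup>2 * (2 * R + 2 * B)"
    proof -
      have "2 ^ k0 * real l \<le> real n" using Nn' by (metis of_nat_le_iff of_nat_mult of_nat_numeral of_nat_power)
      then have "2 * (2 ^ k0 * real l) * (real n * B) \<le> 2 * real n * (real n * B)"
        using B_nonneg by (intro mult_right_mono mult_left_mono) auto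
      then show ?thesis by (simp add: power2_eq_square algebra_simps)
    qed
    also have "\<dots> < (real n)\<^sup>2 * ((3 / 2) ^ k0 * a1 / (real d + 1))"
    proof (rule mult_strict_left_mono[OF _ n2])
      have d1: "real d + 1 > 0" by simp
      show "2 * R + 2 * B < (3 / 2) ^ k0 * a1 / (real d + 1)"
        using k0 unfolding pos_divide_less_eq[OF a1] pos_less_divide_eq[OF d1] .
    qed
    also have "\<dots> = 3 ^ k0 * (4 * c * (real n)\<^sup>2)"
      by (simp add: c_def D' power_divide mult_ac)
    also have "\<dots> \<le> 3 ^ k0 * ((real n)\<^sup>2 * (7 * c) - c * (real n)\<^sup>2 - 3 / 2)"
      using n_large(1) by (intro mult_left_mono) (auto simp: algebra_simps)
    finally show "(real n)\<^sup>2 * (2 * R) + 2 * (2 ^ k0 * real l) * (real n * B)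
        < 3 ^ k0 * ((real n)\<^sup>2 * (7 * c) - c * (real n)\<^sup>2 - 3 / 2)" .
  qed (use c in auto)
  then obtain k z where k: "k < k0" and z: "z \<in> configurations K n"
    and max: "\<And>z'. z' \<in> configurations K n \<Longrightarrow>
      A z' - 2 * (2 ^ k * real l) * W z' \<le> A z - 2 * (2 ^ k * real l) * W z + 1"
    and gt: "A z - 2 ^ k * real l * W z > c * (real n)\<^sup>2" by blast
  define N where "N = 2 ^ k * l"
  have N: "real N = 2 ^ k * real l" by (simp add: N_def)
  have "N \<le> 2 ^ k0 * l" unfolding N_def using k by (intro mult_right_mono power_increasing) auto
  then have Nle: "N \<le> n" "d * N \<le> d * (2 ^ k0 * l)" using Nn' by auto
  have "d * (2 ^ k0 * l) < n" using Nn l by (auto simp: algebra_simps)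
  then have degN: "degree (g j) * N < n"
    using d[OF j] Nle(2) by (meson le_less_trans mult_le_mono1)
  have max': "weighted_energy n (\<lambda>x. 2 * real N * ln (cmod (poly (g j) x))) z' \<le>
      weighted_energy n (\<lambda>x. 2 * real N * ln (cmod (poly (g j) x))) z + 1"
    if "z' \<in> configurations K n" for z'
    unfolding we using max[OF that] unfolding N .
  define M where "M i = cmod (poly (deleted_product n z i) (z i)) / cmod (poly (g j) (z i)) ^ N" for i
  obtain b where b: "b < n" "exp (c * real n) \<le> M b"
    using exists_large_deleted_product[OF z n(2) gK gt[folded N, unfolded A_def W_def f_def]]
    unfolding M_def by blast
  define \<mu> where "\<mu> = exp (c / 2 * real n) / \<kappa>"
  have \<mu>: "\<mu> > 0" using \<kappa> by (simp add: \<mu>_def)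
  \<comment> \<open>The large value at the single node \<open>b\<close> spreads to every node by
    comparison with \<open>b\<close>.\<close>
  have lower: "\<mu> \<le> M i" if i: "i < n" for i
  proof (cases "i = b")
    case True
    have "\<mu> \<le> exp (c / 2 * real n) / 1" unfolding \<mu>_def using \<kappa> by (intro divide_left_mono) auto
    also have "\<dots> \<le> exp (c * real n)" using c by simp
    finally show ?thesis using True b by simp
  next
    case False
    have zb: "z b \<in> K" using z b by (auto simp: configurations_def)
    obtain u where u: "cmod u = 1" "\<And>s. s \<in> {0..\<tau>0} \<Longrightarrow> z b + of_real s * u \<in> K"
      using \<tau>0(2)[OF zb] by blast
    have seg: "z b + of_real s * u \<in> K" if "s \<in> {0..\<tau>}" for s
      using u(2)[of s] that \<tau>(2) by auto
    have osc: "cmod (poly (g j) (z b + of_real s * u)) \<le> exp (c / 4) * cmod (poly (g j) (z b))"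
      if "s \<in> {0..\<tau>}" for s
      using \<tau>1(2)[OF zb seg[OF that]] that \<tau>(3) u(1) by (simp add: dist_norm norm_mult)
    have "M b \<le> (\<rho> ^ n * exp (c / 4) ^ N * (exp 1 * (2 * R / r))) * M i"
      unfolding M_def
      by (rule near_maximiser_comparison[OF z max' gK Kball R \<tau>(1) \<rho> r(1,2) r(3)[unfolded X_def] u(1) seg osc i b(1) False])
    also have "\<dots> \<le> (exp (c / 4) ^ n * exp (c / 4) ^ n * \<kappa>) * M i"
      unfolding \<rho>_def using \<kappa> Nle(1) c r(1) R
      by (intro mult_right_mono mult_mono power_increasing) (auto simp: M_def)
    also have "exp (c / 4) ^ n * exp (c / 4) ^ n = exp (c / 2 * real n)"
      by (simp add: exp_of_nat_mult[symmetric] exp_add[symmetric] mult.commute)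
    finally have "exp (c * real n) \<le> exp (c / 2 * real n) * \<kappa> * M i" using b(2) by simp
    moreover have "exp (c * real n) = exp (c / 2 * real n) * exp (c / 2 * real n)"
      by (simp add: exp_add[symmetric])
    ultimately have "exp (c / 2 * real n) \<le> \<kappa> * M i" by (simp add: mult.assoc)
    then show ?thesis using \<kappa>(1) by (simp add: \<mu>_def field_simps)
  qed
  define p where "p = (\<Prod>i<n. [:- z i, 1:])"
  have zK: "z i \<in> K" if "i < n" for i using z that by (auto simp: configurations_def)
  have "p \<in> monic_polys_with_zeros_in n K"
    unfolding monic_polys_with_zeros_in_def
  proof (intro CollectI conjI allI impI)
    show "degree p = n" unfolding p_def by (subst degree_prod_sum_eq) auto
    show "lead_coeff p = 1" unfolding p_def by (subst lead_coeff_prod) auto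
    show "x \<in> K" if "poly p x = 0" for x
      using that zK by (auto simp: p_def poly_prod)
  qed
  then have "kappa n K 1 \<le> emeasure lebesgue (lemniscate p 1)"
    unfolding kappa_def by (rule INF_lower)
  \<comment> \<open>Strip and squares each contribute at most \<open>\<epsilon> / 2\<close>.\<close>
  also have "\<dots> \<le> ennreal (4 * \<delta> * R + 4 * real n * (real n / \<mu>)\<^sup>2)"
    unfolding p_def
  proof (rule emeasure_lemniscate_le[where t = "t j"])
    show "\<exists>i<n. dist x (z i) \<le> real n / \<mu>"
      if "cmod x \<le> R" "\<bar>Re x - t j\<bar> > \<delta>" "(\<Prod>i<n. dist x (z i)) \<le> 1" for x
      using small_product_imp_near_node[OF z n(2) gK degN \<mu> _ that(3) g1[OF j that(1,2)]] lower
      by (simp add: M_def)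
  qed (use n R \<delta> \<mu> KR zK in auto)
  also have "4 * \<delta> * R + 4 * real n * (real n / \<mu>)\<^sup>2 \<le> \<epsilon>"
    using n_large(2) R by (simp add: \<mu>_def \<delta>_def)
  finally have "kappa n K 1 \<le> ennreal \<epsilon>" by (simp add: ennreal_leI)
  then show ?thesis using n l by (intro exI[of _ n]) auto
qed

lemma log_capacity_eq_1_iff: "log_capacity K = 1 \<longleftrightarrow> robin_constant K = 0"
  by (cases "robin_constant K") (auto simp: log_capacity_def one_ereal_def zero_ereal_def)

theorem theorem6:
  fixes \<Omega> K :: "complex set"
  assumes "open \<Omega>" and "bounded \<Omega>" and "C2_boundary \<Omega>"
    and "K = closure \<Omega>"
    and "log_capacity K = 1"
  shows "(INF n\<in>{1::nat..}. kappa n K 1) = 0"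
proof -
  have "compact K" using assms(2,4) by (simp add: compact_closure)
  obtain \<tau> where \<tau>: "\<tau> > 0"
    "\<And>w. w \<in> K \<Longrightarrow> \<exists>u. cmod u = 1 \<and> (\<forall>s\<in>{0..\<tau>}. w + of_real s * u \<in> K)"
    using C2_boundary_segments[OF assms(1-3)] assms(4) by blast
  \<comment> \<open>Capacity \<open>1\<close> means that the infimum of the energies is
    \<open>0\<close>.\<close>
  have energy: "\<exists>\<nu>\<in>borel_probs_on K. log_energy \<nu> < ereal \<eta>" if "\<eta> > 0" for \<eta>
  proof -
    have "robin_constant K < ereal \<eta>"
      using assms(5) that by (simp add: log_capacity_eq_1_iff)
    then show ?thesis by (simp add: robin_constant_def INF_less_iff)
  qed
  have small: "(INF n\<in>{1::nat..}. kappa n K 1) \<le> ennreal \<epsilon>" if \<epsilon>: "\<epsilon> > 0" for \<epsilon>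
  proof -
    obtain n where "n \<ge> 1" "kappa n K 1 \<le> ennreal \<epsilon>"
      using exists_degree_kappa_le[OF \<open>compact K\<close> \<tau> energy \<epsilon>] by blast
    then show ?thesis by (intro INF_lower2[of n]) auto
  qed
  have "(INF n\<in>{1::nat..}. kappa n K 1) \<le> 0"
    by (rule ennreal_le_epsilon) (use small in simp)
  then show ?thesis by simp
qed

end
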